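(* Let $\Omega\in(0,\pi)$, let $\mathcal{X}_L$ and $\mathcal{X}_H$ be the classes of band-limited and high-frequency sequences associated with $\Omega$, and let $\mathcal{K}_0$ and $\widehat{\mathcal{K}}$ be the classes of anti-causal kernels and of predicting kernels, all as defined in the context. Let $\mathcal{X}$ be either of the two classes $\mathcal{X}_L$, $\mathcal{X}_H$. Then the following hold. (i) $\mathcal{X}$ is $\ell_2$-predictable in the weak sense with respect to the class $\mathcal{K}_0$. (ii) $\mathcal{X}$ is $\ell_\infty$-predictable in the weak sense with respect to the class $\mathcal{K}_0$ uniformly with respect to the norm $\|X(e^{i\omega})\|_{L_2(-\pi,\pi)}$. (iii) For any $q>2$, $\mathcal{X}$ is $\ell_2$-predictable in the weak sense with respect to the class $\mathcal{K}_0$ uniformly with respect to the norm $\|X(e^{i\omega})\|_{L_q(-\pi,\pi)}$.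
   Context: Sequences. For $r\in[1,\infty)$, $\ell_r$ is the set of all two-sided sequences $x=\{x(t)\}_{t=-\infty}^{\infty}\subset\mathbb{C}$ with $\|x\|_{\ell_r}=\left(\sum_{t=-\infty}^\infty|x(t)|^r\right)^{1/r}<+\infty$; $\ell_\infty$ is the set of those with $\|x\|_{\ell_\infty}=\sup_t|x(t)|<+\infty$. $\ell_r^+$ is the set of $x\in\ell_r$ with $x(t)=0$ for $t=-1,-2,-3,\dots$. Z-transform. $X=\mathcal{Z}x$ is $X(z)=\sum_{t=-\infty}^{\infty}x(t)z^{-t}$. If $x\in\ell_2$, the restriction of $X$ to the unit circle is an element of $L_2$ of the circle, and $x(t)=\frac{1}{2\pi}\int_{-\pi}^{\pi}X(e^{i\omega})e^{i\omega t}\,d\omega$. Hardy spaces. Let $D^c=\{z\in\mathbb{C}:|z|>1\}$. $H^r$ is the Hardy space of functions holomorphic on $D^c$ including the point at infinity. Process classes. For the given $\Omega\in(0,\pi)$ (with $\omega\in[-\pi,\pi]$ and $X=\mathcal{Z}x$), $\mathcal{X}_L=\{x\in\ell_2:\ X(e^{i\omega})=0\text{ if }|\omega|>\Omega\}$ and $\mathcal{X}_H=\{x\in\ell_2:\ X(e^{i\omega})=0\text{ if }|\omega|<\Omega\}$ (equalities for a.e. such $\omega$). Kernel classes. $\mathcal{K}_0$ is the class of all $k\in\ell_\infty$ such that $k(t)=0$ for $t>0$ and $K=\mathcal{Z}k$ can be represented as $K(z)=\frac{z+b}{z+a}$ for some real $a\in(-\infty,-1)\cup(1,+\infty)$ and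 $b\in\mathbb{R}$. $\widehat{\mathcal{K}}$ is the class of all $\widehat k\in\ell_\infty^+$ such that $\widehat K=\mathcal{Z}\widehat k$ belongs to $H^\infty\cap H^2$. Predictability. Let $\mathcal{X}$ be a class of sequences from $\ell_\infty$, $r\in[1,+\infty]$, and let $\widetilde{\mathcal{K}}$ be a class of kernels vanishing for $t>0$. (a) $\mathcal{X}$ is $\ell_r$-predictable in the weak sense with respect to $\widetilde{\mathcal{K}}$ if for any $k\in\widetilde{\mathcal{K}}$ there exists a sequence $\{\widehat k_m\}_{m=1}^{\infty}\subset\widehat{\mathcal{K}}$ (depending only on $\mathcal{X}$ and $k$) such that $\|y-\widehat y_m\|_{\ell_r}\to0$ as $m\to+\infty$ for all $x\in\mathcal{X}$, where $y(t)=\sum_{s=t}^{+\infty}k(t-s)x(s)$ and $\widehat y_m(t)=\sum_{s=-\infty}^{t}\widehat k_m(t-s)x(s)$. (b) Given a norm $\|\cdot\|$ on the set of traces $X(e^{i\omega})$ of $X=\mathcal{Z}x$, $x\in\mathcal{X}$, the class $\mathcal{X}$ is $\ell_r$-predictable in the weak sense with respect to $\widetilde{\mathcal{K}}$ uniformly with respect to the norm $\|\cdot\|$ if for any $k\in\widetilde{\mathcal{K}}$ and $\varepsilon>0$ there exists $\widehat k\in\widehat{\mathcal{K}}$ (depending only on $\mathcal{X}$, $k$, $\|\cdot\|$, $\varepsilon$) such that $\|y-\widehat y\|_{\ell_r}\le\varepsilon\|X\|$ for all $x\in\mathcal{X}$, $X=\mathcal{Z}x$, where $y(t)=\sum_{s=t}^{+\infty}k(t-s)x(s)$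 and $\widehat y(t)=\sum_{s=-\infty}^{t}\widehat k(t-s)x(s)$. The norm $\|X(e^{i\omega})\|_{L_q(-\pi,\pi)}$ is understood as $+\infty$ when $X(e^{i\omega})\notin L_q(-\pi,\pi)$, in which case the inequality is vacuous. *)

theory Defs
  imports "HOL-Complex_Analysis.Complex_Analysis" "HOL-Probability.Essential_Supremum"
begin

text \<open>All norms take values in \<^typ>\<open>ennreal\<close>, so that they are defined for every sequence or
  function and are infinite outside the corresponding space. The exponents range over
  \<^typ>\<open>ennreal\<close> as well, with \<open>\<infinity>\<close> giving the supremum norms.\<close>

definition enn_powr :: "ennreal \<Rightarrow> real \<Rightarrow> ennreal" where
  "enn_powr c p = (if c = \<infinity> then \<infinity> else ennreal (enn2real c powr p))"

definition ell_norm :: "ennreal \<Rightarrow> (int \<Rightarrow> complex) \<Rightarrow> ennreal" where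
  "ell_norm r x =
     (if r = \<infinity> then (SUP t. ennreal (cmod (x t)))
      else enn_powr (\<Sum>\<^sub>\<infinity>t. ennreal (cmod (x t) powr enn2real r)) (1 / enn2real r))"

definition ell :: "ennreal \<Rightarrow> (int \<Rightarrow> complex) set" where
  "ell r = {x. ell_norm r x < \<infinity>}"

definition ell_plus :: "ennreal \<Rightarrow> (int \<Rightarrow> complex) set" where
  "ell_plus r = {x \<in> ell r. \<forall>t<0. x t = 0}"

text \<open>A function on the unit circle is represented as a function of the angle \<open>\<omega> \<in> [-\<pi>, \<pi>]\<close>;
  its values at other real numbers are irrelevant.\<close>

abbreviation circ :: "real measure" where
  "circ \<equiv> lebesgue_on {-pi..pi}"

definition L_norm :: "ennreal \<Rightarrow> (real \<Rightarrow> complex) \<Rightarrow> ennreal" where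
  "L_norm r F =
     (if r = \<infinity> then esssup circ (\<lambda>\<omega>. ennreal (cmod (F \<omega>)))
      else enn_powr (\<integral>\<^sup>+\<omega>. ennreal (cmod (F \<omega>) powr enn2real r) \<partial>circ) (1 / enn2real r))"

definition ztransform :: "(int \<Rightarrow> complex) \<Rightarrow> complex \<Rightarrow> complex" where
  "ztransform x z = (\<Sum>\<^sub>\<infinity>t. x t * z powi (- t))"

text \<open>For square summable \<open>x\<close> the series of the Z-transform need not converge pointwise on the unit
  circle; its restriction to the circle is its sum in \<open>L\<^sub>2\<close>. As an \<open>L\<^sub>2\<close> function this sum is determined
  up to null sets, so it is given as a relation between \<open>x\<close> and representatives
  \<open>F \<omega> = X(e\<^sup>i\<^sup>\<omega>)\<close>. By the Riesz-Fischer theorem a representative exists for every \<open>x \<in> ell 2\<close>.\<close>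

definition is_trace :: "(int \<Rightarrow> complex) \<Rightarrow> (real \<Rightarrow> complex) \<Rightarrow> bool" where
  "is_trace x F \<longleftrightarrow>
     F \<in> borel_measurable circ \<and> L_norm 2 F < \<infinity> \<and>
     (\<lambda>n. L_norm 2 (\<lambda>\<omega>. F \<omega> - (\<Sum>t=-int n..int n. x t * cis \<omega> powi (- t)))) \<longlonglongrightarrow> 0"

text \<open>Holomorphy at infinity means that \<open>z \<mapsto> h (1/z)\<close> extends holomorphically over \<open>0\<close>. Values of
  \<open>h\<close> in the closed unit disc are irrelevant.\<close>

definition hardy :: "ennreal \<Rightarrow> (complex \<Rightarrow> complex) set" where
  "hardy r = {h. h holomorphic_on {z. 1 < cmod z} \<and>
     (\<exists>g. g holomorphic_on ball 0 1 \<and> (\<forall>z. 0 < cmod z \<and> cmod z < 1 \<longrightarrow> g z = h (1 / z))) \<and>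
     (SUP \<rho>\<in>{1<..}. L_norm r (\<lambda>\<omega>. h (of_real \<rho> * cis \<omega>))) < \<infinity>}"

definition band_limited :: "real \<Rightarrow> (int \<Rightarrow> complex) set" where
  "band_limited \<Omega> =
     {x \<in> ell 2. \<exists>F. is_trace x F \<and> (AE \<omega> in circ. \<bar>\<omega>\<bar> > \<Omega> \<longrightarrow> F \<omega> = 0)}"

definition high_frequency :: "real \<Rightarrow> (int \<Rightarrow> complex) set" where
  "high_frequency \<Omega> =
     {x \<in> ell 2. \<exists>F. is_trace x F \<and> (AE \<omega> in circ. \<bar>\<omega>\<bar> < \<Omega> \<longrightarrow> F \<omega> = 0)}"

text \<open>For a bounded \<open>k\<close> vanishing at positive times, the Z-transform is a power series in \<open>z\<close>
  converging in the open unit disc. As \<open>\<bar>a\<bar> > 1\<close>, the identity there determines \<open>k\<close>, which decays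
  like \<open>\<bar>a\<bar> powr t\<close> as \<open>t \<rightarrow> -\<infinity>\<close>; hence the identity extends to \<open>cmod z < \<bar>a\<bar>\<close>.\<close>

definition K0 :: "(int \<Rightarrow> complex) set" where
  "K0 = {k \<in> ell \<infinity>. (\<forall>t>0. k t = 0) \<and>
     (\<exists>a b :: real. (a < -1 \<or> 1 < a) \<and>
        (\<forall>z. cmod z < 1 \<longrightarrow> ztransform k z = (z + of_real b) / (z + of_real a)))}"

definition Khat :: "(int \<Rightarrow> complex) set" where
  "Khat = {k \<in> ell_plus \<infinity>. ztransform k \<in> hardy \<infinity> \<inter> hardy 2}"

definition anticausal_conv :: "(int \<Rightarrow> complex) \<Rightarrow> (int \<Rightarrow> complex) \<Rightarrow> int \<Rightarrow> complex" where
  "anticausal_conv k x t = (\<Sum>\<^sub>\<infinity>s\<in>{t..}. k (t - s) * x s)"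

definition causal_conv :: "(int \<Rightarrow> complex) \<Rightarrow> (int \<Rightarrow> complex) \<Rightarrow> int \<Rightarrow> complex" where
  "causal_conv k x t = (\<Sum>\<^sub>\<infinity>s\<in>{..t}. k (t - s) * x s)"

definition weakly_predictable ::
    "ennreal \<Rightarrow> (int \<Rightarrow> complex) set \<Rightarrow> (int \<Rightarrow> complex) set \<Rightarrow> bool" where
  "weakly_predictable r \<K> \<X> \<longleftrightarrow>
     (\<forall>k\<in>\<K>. \<exists>\<kappa> :: nat \<Rightarrow> int \<Rightarrow> complex. (\<forall>m. \<kappa> m \<in> Khat) \<and>
        (\<forall>x\<in>\<X>. (\<lambda>m. ell_norm r (\<lambda>t. anticausal_conv k x t - causal_conv (\<kappa> m) x t))
           \<longlonglongrightarrow> 0))"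

text \<open>The norm \<open>N\<close> may be infinite on some traces, for which the inequality is vacuous.\<close>

definition weakly_predictable_uniformly ::
    "ennreal \<Rightarrow> (int \<Rightarrow> complex) set \<Rightarrow> ((real \<Rightarrow> complex) \<Rightarrow> ennreal) \<Rightarrow>
     (int \<Rightarrow> complex) set \<Rightarrow> bool" where
  "weakly_predictable_uniformly r \<K> N \<X> \<longleftrightarrow>
     (\<forall>k\<in>\<K>. \<forall>\<epsilon>::real. \<epsilon> > 0 \<longrightarrow> (\<exists>\<kappa>\<in>Khat. \<forall>x\<in>\<X>. \<forall>F. is_trace x F \<longrightarrow>
        ell_norm r (\<lambda>t. anticausal_conv k x t - causal_conv \<kappa> x t) \<le> ennreal \<epsilon> * N F))"

end

theory Submission
  imports Defs
begin

text \<open>The kernels in \<open>K0\<close> look into the future, yet on either class they can be imitated by causal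
  ones, because the traces vanish on a set of frequencies of positive length. Applying \<open>k\<close> to \<open>x\<close>
  multiplies the trace of \<open>x\<close> by \<open>K(z) = (z + b) / (z + a)\<close> on the unit circle, and only the values
  of \<open>K\<close> on the closed arc carrying the trace matter. In the variable \<open>w = 1 / z\<close> the function \<open>K\<close>
  is rational with its only pole at \<open>- 1 / a\<close>, inside the unit disc, so no polynomial in \<open>w\<close> can be
  close to it on the whole circle. A proper arc, however, does not separate the plane, and there
  Runge's argument applies: the pole can be pushed to infinity without touching the arc, hence \<open>K\<close> is
  a uniform limit of polynomials in \<open>w\<close> on the arc (\<open>poly_approximable_simple_pole\<close>,
  \<open>transfer_function_approximable\<close>).

  A polynomial in \<open>1 / z\<close> is the Z-transform of a finitely supported causal kernel, which lies in
  \<open>Khat\<close> (\<open>poly_kernel_in_Khat\<close>). If it is within \<open>\<epsilon>\<close> of \<open>K\<close> on the arc, then the prediction error is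
  the sequence of Fourier coefficients of a function bounded by \<open>\<epsilon>\<close> times the modulus of the trace,
  and Bessel's inequality bounds its \<open>\<ell>\<^sub>2\<close> norm by \<open>\<epsilon>\<close> times the \<open>L\<^sub>2\<close> norm of the trace
  (\<open>prediction_error_le\<close>, \<open>uniform_predictor\<close>). All three claims are consequences of this one uniform
  estimate: for the first let \<open>\<epsilon>\<close> run through a null sequence, for the second note that the
  \<open>\<ell>\<^sub>2\<close> norm dominates the supremum norm, and for the third that the \<open>L\<^sub>q\<close> norm dominates the
  \<open>L\<^sub>2\<close> norm up to a factor, because the circle has finite measure.\<close>

section \<open>Polynomial approximation on sets that do not separate the plane\<close>

definition poly_approximable :: "complex set \<Rightarrow> (complex \<Rightarrow> complex) \<Rightarrow> bool" where
  "poly_approximable A f \<longleftrightarrow> (\<forall>e>0. \<exists>P. \<forall>w\<in>A. cmod (f w - poly P w) \<le> e)"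

lemma poly_approximableD:
  assumes "poly_approximable A f" "e > 0"
  obtains P where "\<And>w. w \<in> A \<Longrightarrow> cmod (f w - poly P w) \<le> e"
  using assms unfolding poly_approximable_def by blast

lemma poly_approximable_cong:
  assumes "poly_approximable A f" "\<And>w. w \<in> A \<Longrightarrow> f w = g w"
  shows "poly_approximable A g"
  using assms unfolding poly_approximable_def by metis

lemma poly_approximable_poly: "poly_approximable A (poly P)"
  unfolding poly_approximable_def by (metis diff_self norm_zero less_imp_le)

lemma poly_approximable_const: "poly_approximable A (\<lambda>w. c)"
  by (rule poly_approximable_cong[OF poly_approximable_poly[of A "[:c:]"]]) simp

lemma poly_approximable_ident: "poly_approximable A (\<lambda>w. w)"
  by (rule poly_approximable_cong[OF poly_approximable_poly[of A "[:0, 1:]"]]) simp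

lemma poly_approximable_add:
  assumes "poly_approximable A f" "poly_approximable A g"
  shows "poly_approximable A (\<lambda>w. f w + g w)"
  unfolding poly_approximable_def
proof (intro allI impI)
  fix e :: real assume "e > 0"
  then obtain P Q where P: "\<And>w. w \<in> A \<Longrightarrow> cmod (f w - poly P w) \<le> e / 2"
    and Q: "\<And>w. w \<in> A \<Longrightarrow> cmod (g w - poly Q w) \<le> e / 2"
    using assms by (metis poly_approximableD half_gt_zero)
  have "cmod (f w + g w - poly (P + Q) w) \<le> e" if "w \<in> A" for w
  proof -
    have "f w + g w - poly (P + Q) w = (f w - poly P w) + (g w - poly Q w)" by simp
    then show ?thesis using norm_triangle_ineq P[OF that] Q[OF that]
      by (smt (verit) field_sum_of_halves)
  qed
  then show "\<exists>P. \<forall>w\<in>A. cmod (f w + g w - poly P w) \<le> e" by blast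
qed

lemma poly_bounded_on:
  assumes "bounded A"
  obtains B where "B > 0" "\<And>w. w \<in> A \<Longrightarrow> cmod (poly P w) \<le> B"
proof -
  have "compact (poly P ` closure A)"
    using assms by (intro compact_continuous_image continuous_intros) (simp add: compact_closure)
  then have "bounded (poly P ` A)"
    by (meson bounded_subset closure_subset compact_imp_bounded image_mono)
  then show thesis using that unfolding bounded_pos by auto
qed

lemma poly_approximable_mult:
  assumes A: "bounded A" and f: "poly_approximable A f" and g: "poly_approximable A g"
  shows "poly_approximable A (\<lambda>w. f w * g w)"
  unfolding poly_approximable_def
proof (intro allI impI)
  fix e :: real assume e: "e > 0"
  obtain P0 where P0: "\<And>w. w \<in> A \<Longrightarrow> cmod (f w - poly P0 w) \<le> 1"
    using poly_approximableD[OF f, of 1] by auto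
  obtain B0 where B0: "B0 > 0" "\<And>w. w \<in> A \<Longrightarrow> cmod (poly P0 w) \<le> B0"
    using poly_bounded_on[OF A] by metis
  have fB: "cmod (f w) \<le> B0 + 1" if "w \<in> A" for w
    using norm_triangle_ineq[of "f w - poly P0 w" "poly P0 w"] P0[OF that] B0(2)[OF that] by simp
  have "e / (2 * (B0 + 1)) > 0" using e B0 by simp
  then obtain Q where Q: "\<And>w. w \<in> A \<Longrightarrow> cmod (g w - poly Q w) \<le> e / (2 * (B0 + 1))"
    using poly_approximableD[OF g] by metis
  obtain B1 where B1: "B1 > 0" "\<And>w. w \<in> A \<Longrightarrow> cmod (poly Q w) \<le> B1"
    using poly_bounded_on[OF A] by metis
  have "e / (2 * B1) > 0" using e B1 by simp
  then obtain P where P: "\<And>w. w \<in> A \<Longrightarrow> cmod (f w - poly P w) \<le> e / (2 * B1)"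
    using poly_approximableD[OF f] by metis
  have "cmod (f w * g w - poly (P * Q) w) \<le> e" if w: "w \<in> A" for w
  proof -
    have "f w * g w - poly (P * Q) w = f w * (g w - poly Q w) + (f w - poly P w) * poly Q w"
      by (simp add: algebra_simps)
    also have "cmod \<dots> \<le> cmod (f w) * cmod (g w - poly Q w) + cmod (f w - poly P w) * cmod (poly Q w)"
      by (metis norm_mult norm_triangle_ineq)
    also have "\<dots> \<le> (B0 + 1) * (e / (2 * (B0 + 1))) + e / (2 * B1) * B1"
      using fB[OF w] Q[OF w] P[OF w] B1(1) B1(2)[OF w] B0(1) e by (intro add_mono mult_mono) auto
    also have "\<dots> = e" using B0 B1 by (simp add: field_simps)
    finally show ?thesis .
  qed
  then show "\<exists>P. \<forall>w\<in>A. cmod (f w * g w - poly P w) \<le> e" by blast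
qed

lemma poly_approximable_uniform_limit:
  assumes "\<And>e. e > 0 \<Longrightarrow> \<exists>g. poly_approximable A g \<and> (\<forall>w\<in>A. cmod (f w - g w) \<le> e)"
  shows "poly_approximable A f"
  unfolding poly_approximable_def
proof (intro allI impI)
  fix e :: real assume e: "e > 0"
  then obtain g where g: "poly_approximable A g" "\<forall>w\<in>A. cmod (f w - g w) \<le> e / 2"
    using assms half_gt_zero by metis
  then obtain P where P: "\<And>w. w \<in> A \<Longrightarrow> cmod (g w - poly P w) \<le> e / 2"
    using e by (metis poly_approximableD half_gt_zero)
  have "cmod (f w - poly P w) \<le> e" if "w \<in> A" for w
    using norm_triangle_ineq[of "f w - g w" "g w - poly P w"] g(2) P[OF that] that by force
  then show "\<exists>P. \<forall>w\<in>A. cmod (f w - poly P w) \<le> e" by blast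
qed

text \<open>The partial sums of the geometric series in \<open>q\<close> converge uniformly on \<open>A\<close>, because \<open>cmod (q w)\<close>
  stays below a fixed \<open>r < 1\<close>.\<close>

lemma poly_approximable_geometric:
  assumes A: "bounded A" and q: "poly_approximable A q"
    and r: "\<And>w. w \<in> A \<Longrightarrow> cmod (q w) \<le> r" "r < 1"
  shows "poly_approximable A (\<lambda>w. 1 / (1 - q w))"
proof (cases "A = {}")
  case True
  then show ?thesis by (simp add: poly_approximable_def)
next
  case False
  then have r0: "0 \<le> r" using r(1) norm_ge_zero order_trans by blast
  have pow: "poly_approximable A (\<lambda>w. q w ^ n)" for n
    by (induction n) (auto intro: poly_approximable_const poly_approximable_mult[OF A q])
  have partial: "poly_approximable A (\<lambda>w. \<Sum>i<n. q w ^ i)" for n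
    by (induction n) (auto intro: poly_approximable_const poly_approximable_add pow)
  show ?thesis
  proof (rule poly_approximable_uniform_limit)
    fix e :: real assume "e > 0"
    moreover have "(\<lambda>n. r ^ n / (1 - r)) \<longlonglongrightarrow> 0"
      using r0 r(2) by (auto intro!: tendsto_eq_intros LIMSEQ_power_zero)
    ultimately obtain n where n: "r ^ n / (1 - r) < e"
      by (metis (no_types, lifting) order_tendstoD(2) eventually_sequentially order_refl)
    have "cmod (1 / (1 - q w) - (\<Sum>i<n. q w ^ i)) \<le> e" if w: "w \<in> A" for w
    proof -
      have ne: "q w \<noteq> 1" using r(1)[OF w] r(2) by auto
      have "1 / (1 - q w) - (\<Sum>i<n. q w ^ i) = q w ^ n / (1 - q w)"
        using ne by (simp add: geometric_sum field_simps)
      also have "cmod \<dots> \<le> r ^ n / (1 - r)"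
        unfolding norm_divide norm_power using r(1)[OF w] r(2) r0 norm_triangle_ineq2[of 1 "q w"]
        by (intro frac_le power_mono) auto
      finally show ?thesis using n by simp
    qed
    with partial show "\<exists>g. poly_approximable A g \<and> (\<forall>w\<in>A. cmod (1 / (1 - q w) - g w) \<le> e)" by blast
  qed
qed

text \<open>A pole can be moved over any distance smaller than its distance \<open>d\<close> to \<open>A\<close>:
  \<open>1 / (w - p') = 1 / (w - p) \<cdot> 1 / (1 - (p' - p) / (w - p))\<close>, and the second factor is a uniformly
  convergent geometric series.\<close>

lemma pole_pushing_step:
  assumes A: "bounded A" and p: "poly_approximable A (\<lambda>w. 1 / (w - p))"
    and d: "\<And>w. w \<in> A \<Longrightarrow> d \<le> cmod (w - p)" "cmod (p' - p) < d"
  shows "poly_approximable A (\<lambda>w. 1 / (w - p'))"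
proof -
  have d0: "d > 0" using d(2) norm_ge_zero le_less_trans by blast
  have "poly_approximable A (\<lambda>w. (p' - p) * (1 / (w - p)))"
    by (intro poly_approximable_mult[OF A] poly_approximable_const p)
  moreover have "cmod ((p' - p) * (1 / (w - p))) \<le> cmod (p' - p) / d" if "w \<in> A" for w
    using d(1)[OF that] d0 by (simp add: norm_mult norm_divide frac_le)
  moreover have "cmod (p' - p) / d < 1" using d(2) d0 by simp
  ultimately have "poly_approximable A (\<lambda>w. 1 / (1 - (p' - p) * (1 / (w - p))))"
    by (rule poly_approximable_geometric[OF A])
  then have "poly_approximable A (\<lambda>w. 1 / (w - p) * (1 / (1 - (p' - p) * (1 / (w - p)))))"
    by (rule poly_approximable_mult[OF A p])
  then show ?thesis
  proof (rule poly_approximable_cong)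
    fix w assume "w \<in> A"
    then have "w \<noteq> p" "w \<noteq> p'" using d d0 by (force simp: norm_minus_commute)+
    then show "1 / (w - p) * (1 / (1 - (p' - p) * (1 / (w - p)))) = 1 / (w - p')"
      by (simp add: divide_simps)
  qed
qed

text \<open>This is the case of Runge's theorem used for the transfer functions below. A pole far away from
  \<open>A\<close> is harmless, since there \<open>1 / (w - p)\<close> is a geometric series in \<open>w\<close> itself. Pole pushing in both
  directions shows that approximability does not change under small moves of the pole, so on the
  connected set \<open>- A\<close> it does not depend on the pole at all.\<close>

theorem poly_approximable_simple_pole:
  assumes A: "compact A" and conn: "connected (- A)" and p: "p \<notin> A"
  shows "poly_approximable A (\<lambda>w. 1 / (w - p))"
proof -
  have bA: "bounded A" using A compact_imp_bounded by blast
  then obtain B where B: "B > 0" "\<And>w. w \<in> A \<Longrightarrow> cmod w \<le> B" unfolding bounded_pos by auto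
  \<comment> \<open>twice the radius of \<open>A\<close>, so that the geometric series has ratio at most \<open>1/2\<close>\<close>
  define p0 :: complex where "p0 = of_real (2 * B)"
  have p0: "cmod p0 = 2 * B" using B by (simp add: p0_def norm_mult)
  have far: "poly_approximable A (\<lambda>w. 1 / (w - p0))"
  proof -
    have "poly_approximable A (\<lambda>w. (1 / p0) * w)"
      by (intro poly_approximable_mult[OF bA] poly_approximable_const poly_approximable_ident)
    moreover have "cmod ((1 / p0) * w) \<le> 1 / 2" if "w \<in> A" for w
      using B(1) B(2)[OF that] by (simp add: norm_mult norm_divide p0)
    ultimately have "poly_approximable A (\<lambda>w. 1 / (1 - (1 / p0) * w))"
      by (rule poly_approximable_geometric[OF bA]) auto
    then have "poly_approximable A (\<lambda>w. (- 1 / p0) * (1 / (1 - (1 / p0) * w)))"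
      by (intro poly_approximable_mult[OF bA] poly_approximable_const)
    then show ?thesis
    proof (rule poly_approximable_cong)
      fix w assume "w \<in> A"
      then have "w \<noteq> p0" "p0 \<noteq> 0" using B p0 by force+
      then show "- 1 / p0 * (1 / (1 - 1 / p0 * w)) = 1 / (w - p0)"
        by (simp add: divide_simps)
    qed
  qed
  have p0A: "p0 \<in> - A" using B p0 by force
  have "poly_approximable A (\<lambda>w. 1 / (w - p0)) \<longleftrightarrow> poly_approximable A (\<lambda>w. 1 / (w - p))"
  proof (rule connected_equivalence_relation[OF conn p0A])
    show "p \<in> - A" using p by simp
  next
    fix a assume "a \<in> - A"
    moreover have "open (- A)" using A compact_imp_closed by blast
    ultimately obtain d where d: "d > 0" "ball a d \<subseteq> - A" using open_contains_ball by blast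
    have da: "d \<le> cmod (w - a)" if "w \<in> A" for w
      using d(2) that by (force simp: dist_norm norm_minus_commute)
    \<comment> \<open>radius \<open>d/2\<close> leaves \<open>b\<close> at distance at least \<open>d/2\<close> from \<open>A\<close>, so that the step can be reversed\<close>
    have "poly_approximable A (\<lambda>w. 1 / (w - a)) \<longleftrightarrow> poly_approximable A (\<lambda>w. 1 / (w - b))"
      if b: "b \<in> ball a (d / 2)" for b
    proof
      have ab: "cmod (b - a) < d / 2" using b by (simp add: dist_norm norm_minus_commute)
      show "poly_approximable A (\<lambda>w. 1 / (w - b))" if "poly_approximable A (\<lambda>w. 1 / (w - a))"
        using pole_pushing_step[OF bA that da] ab d(1) by simp
      have db: "d / 2 \<le> cmod (w - b)" if "w \<in> A" for w
        using da[OF that] ab norm_triangle_ineq[of "w - b" "b - a"] by simp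
      show "poly_approximable A (\<lambda>w. 1 / (w - a))" if "poly_approximable A (\<lambda>w. 1 / (w - b))"
        using pole_pushing_step[OF bA that db] ab by (simp add: norm_minus_commute)
    qed
    moreover have "openin (top_of_set (- A)) (ball a (d / 2))"
      using d subset_ball[of "d / 2" d a] \<open>open (- A)\<close> by (auto simp: openin_open_eq)
    ultimately show "\<exists>T. openin (top_of_set (- A)) T \<and> a \<in> T \<and> (\<forall>b\<in>T.
        poly_approximable A (\<lambda>w. 1 / (w - a)) \<longleftrightarrow> poly_approximable A (\<lambda>w. 1 / (w - b)))"
      using d(1) by (intro exI[of _ "ball a (d / 2)"]) auto
  qed auto
  with far show ?thesis by blast
qed

text \<open>The bound \<open>t - s < 2 * pi\<close> is essential: on the full circle a pole inside the disc is not
  approximable, by the maximum principle. A proper arc does not separate the plane.\<close>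

lemma arc_simple_pole_approximable:
  assumes "s < t" "t - s < 2 * pi" and p: "cmod p \<noteq> 1"
  shows "poly_approximable (cis ` {s..t}) (\<lambda>w. 1 / (w - p))"
proof -
  let ?g = "part_circlepath 0 1 s t"
  have im: "path_image ?g = cis ` {s..t}"
    using assms by (simp add: path_image_part_circlepath' closed_segment_eq_real_ivl)
  have arc: "arc ?g" using assms by (intro arc_part_circlepath) auto
  have "compact (cis ` {s..t})" using im compact_arc_image[OF arc] by simp
  moreover have "connected (- (cis ` {s..t}))"
    using connected_arc_complement[OF arc] by (simp add: im)
  moreover have "p \<notin> cis ` {s..t}" using p by auto
  ultimately show ?thesis by (rule poly_approximable_simple_pole)
qed

section \<open>The norms\<close>

lemma ennreal_power2_le_imp_le:
  fixes a b :: ennreal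
  assumes "a\<^sup>2 \<le> b\<^sup>2"
  shows "a \<le> b"
proof (rule ccontr)
  assume "\<not> a \<le> b"
  then have "b < a" by simp
  then obtain r where r: "b = ennreal r" "0 \<le> r" by (cases b) auto
  have "b\<^sup>2 < a\<^sup>2"
  proof (cases a)
    case (real s)
    then have "r\<^sup>2 < s\<^sup>2" using \<open>b < a\<close> r by (intro power_strict_mono) (auto simp: ennreal_less_iff)
    then show ?thesis using real r by (simp add: ennreal_power ennreal_less_iff)
  next
    case top
    then show ?thesis using r by (simp add: ennreal_power)
  qed
  then show False using assms by simp
qed

lemma enn_powr_half_power2: "(enn_powr c (1 / 2))\<^sup>2 = c"
proof (cases c)
  case (real r)
  then show ?thesis by (simp add: enn_powr_def ennreal_power powr_half_sqrt)
qed (simp add: enn_powr_def power2_eq_square)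

text \<open>Working with squared norms turns estimates between the norms into estimates between integrals and
  sums, which \<open>ennreal_power2_le_imp_le\<close> transfers back.\<close>

lemma L_norm_2_power2: "(L_norm 2 F)\<^sup>2 = (\<integral>\<^sup>+\<omega>. ennreal ((cmod (F \<omega>))\<^sup>2) \<partial>circ)"
proof -
  have *: "cmod z powr 2 = (cmod z)\<^sup>2" for z by (cases "z = 0") (auto simp: powr_numeral)
  show ?thesis by (simp add: L_norm_def enn_powr_half_power2 *)
qed

lemma ell_norm_2_power2: "(ell_norm 2 x)\<^sup>2 = (\<Sum>\<^sub>\<infinity>t. ennreal ((cmod (x t))\<^sup>2))"
proof -
  have *: "cmod z powr 2 = (cmod z)\<^sup>2" for z by (cases "z = 0") (auto simp: powr_numeral)
  show ?thesis by (simp add: ell_norm_def enn_powr_half_power2 *)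
qed

lemma L_norm_2_mono_AE:
  assumes "AE \<omega> in circ. cmod (G \<omega>) \<le> M * cmod (F \<omega>)" "0 \<le> M"
    and "F \<in> borel_measurable circ"
  shows "L_norm 2 G \<le> ennreal M * L_norm 2 F"
proof (rule ennreal_power2_le_imp_le)
  have "(L_norm 2 G)\<^sup>2 \<le> (\<integral>\<^sup>+\<omega>. ennreal (M\<^sup>2) * ennreal ((cmod (F \<omega>))\<^sup>2) \<partial>circ)"
    unfolding L_norm_2_power2
  proof (rule nn_integral_mono_AE, use assms(1) in eventually_elim)
    fix \<omega> assume "cmod (G \<omega>) \<le> M * cmod (F \<omega>)"
    then have "(cmod (G \<omega>))\<^sup>2 \<le> M\<^sup>2 * (cmod (F \<omega>))\<^sup>2"
      by (metis power_mono power_mult_distrib norm_ge_zero)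
    then show "ennreal ((cmod (G \<omega>))\<^sup>2) \<le> ennreal (M\<^sup>2) * ennreal ((cmod (F \<omega>))\<^sup>2)"
      by (simp add: ennreal_mult[symmetric])
  qed
  also have "\<dots> = ennreal (M\<^sup>2) * (L_norm 2 F)\<^sup>2"
    unfolding L_norm_2_power2 using assms(3) by (intro nn_integral_cmult) measurable
  also have "\<dots> = (ennreal M * L_norm 2 F)\<^sup>2"
    using assms(2) by (simp add: power_mult_distrib ennreal_power)
  finally show "(L_norm 2 G)\<^sup>2 \<le> (ennreal M * L_norm 2 F)\<^sup>2" .
qed

lemma ell_norm_infinity_le_ell_norm_2: "ell_norm \<infinity> x \<le> ell_norm 2 x"
proof -
  have "ennreal (cmod (x t)) \<le> ell_norm 2 x" for t
  proof (rule ennreal_power2_le_imp_le)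
    have "(\<Sum>s\<in>{t}. ennreal ((cmod (x s))\<^sup>2)) \<le> (\<Sum>\<^sub>\<infinity>s. ennreal ((cmod (x s))\<^sup>2))"
    proof (subst nonneg_infsum_complete)
      show "(\<Sum>s\<in>{t}. ennreal ((cmod (x s))\<^sup>2))
          \<le> (SUP S\<in>{S. finite S \<and> S \<subseteq> UNIV}. \<Sum>s\<in>S. ennreal ((cmod (x s))\<^sup>2))"
        by (rule SUP_upper) simp
    qed simp
    then show "(ennreal (cmod (x t)))\<^sup>2 \<le> (ell_norm 2 x)\<^sup>2"
      by (simp add: ell_norm_2_power2 ennreal_power)
  qed
  then show ?thesis by (simp add: ell_norm_def SUP_le_iff)
qed

lemma finite_measure_circ: "finite_measure circ"
  by (intro finite_measure_lebesgue_on) simp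

lemma emeasure_circ: "emeasure circ {-pi..pi} = ennreal (2 * pi)"
  by (simp add: emeasure_restrict_space)

text \<open>On a space of finite measure the \<open>L\<^sub>q\<close> norms dominate the \<open>L\<^sub>2\<close> norm. Instead of Hoelder's
  inequality, the proof scales by a number \<open>l\<close> slightly above \<open>n = L_norm q F\<close>: for finite \<open>q\<close>, pointwise
  \<open>\<bar>F\<bar>\<^sup>2 \<le> l\<^sup>2 (1 + (\<bar>F\<bar> / l)\<^sup>q)\<close>, and integration gives at most \<open>l\<^sup>2 (2 * pi + 1) \<le> (3 * l)\<^sup>2\<close>.
  Taking \<open>l > n\<close> and letting it tend to \<open>n\<close> includes the case \<open>n = 0\<close>.\<close>

lemma L_norm_2_le_L_norm:
  assumes F: "F \<in> borel_measurable circ" and q: "2 < q"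
  shows "L_norm 2 F \<le> 3 * L_norm q F"
proof (cases "L_norm q F")
  case top
  then show ?thesis by (simp add: ennreal_mult_top)
next
  case (real n)
  have bound: "L_norm 2 F \<le> ennreal (3 * l)" if l: "0 < l" "n \<le> l" for l
  proof -
    have "(\<integral>\<^sup>+\<omega>. ennreal ((cmod (F \<omega>))\<^sup>2) \<partial>circ) \<le> ennreal (l\<^sup>2 * (2 * pi + 1))"
    proof (cases "q = \<infinity>")
      case True
      then have "esssup circ (\<lambda>\<omega>. ennreal (cmod (F \<omega>))) = ennreal n"
        using real by (simp add: L_norm_def)
      with esssup_AE[where M = circ and f = "\<lambda>\<omega>. ennreal (cmod (F \<omega>))"]
      have "AE \<omega> in circ. ennreal ((cmod (F \<omega>))\<^sup>2) \<le> ennreal (l\<^sup>2)"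
        using l real(1) by (auto elim!: eventually_mono intro!: power_mono)
      then have "(\<integral>\<^sup>+\<omega>. ennreal ((cmod (F \<omega>))\<^sup>2) \<partial>circ) \<le> (\<integral>\<^sup>+\<omega>. ennreal (l\<^sup>2) \<partial>circ)"
        by (rule nn_integral_mono_AE)
      also have "\<dots> = ennreal (l\<^sup>2 * (2 * pi))"
        by (simp add: emeasure_circ ennreal_mult)
      also have "\<dots> \<le> ennreal (l\<^sup>2 * (2 * pi + 1))"
        by (intro ennreal_leI mult_left_mono) auto
      finally show ?thesis .
    next
      case False
      then obtain p where p: "q = ennreal p" "p \<ge> 0" by (cases q) auto
      have "ennreal 2 < ennreal p" using q unfolding p(1) by simp
      then have p2: "2 < p" using ennreal_less_iff[of 2 p] by simp
      define I where "I = (\<integral>\<^sup>+\<omega>. ennreal (cmod (F \<omega>) powr p) \<partial>circ)"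
      have "enn_powr I (1 / p) = ennreal n"
        using real p by (simp add: L_norm_def I_def)
      then obtain i where i: "I = ennreal i" "i \<ge> 0" "i powr (1 / p) = n"
        using real(1) by (cases I) (auto simp: enn_powr_def)
      have in': "i = n powr p"
        using p2 i(2) by (simp add: i(3)[symmetric] powr_powr)
      have pw: "(cmod z)\<^sup>2 \<le> l\<^sup>2 + (l\<^sup>2 / l powr p) * cmod z powr p" for z
      proof (cases "cmod z \<le> l")
        case True
        then have "(cmod z)\<^sup>2 \<le> l\<^sup>2" by (simp add: power_mono)
        then show ?thesis by (simp add: add_increasing2)
      next
        case False
        then have c: "1 \<le> cmod z / l" "cmod z > 0" using l by auto
        have "(cmod z / l)\<^sup>2 \<le> (cmod z / l) powr p"
          using powr_mono[of 2 p "cmod z / l"] p2 c l by (simp add: powr_numeral)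
        then have "(cmod z)\<^sup>2 \<le> (l\<^sup>2 / l powr p) * cmod z powr p"
          using l by (simp add: powr_divide power_divide field_simps)
        then show ?thesis by (simp add: add_increasing)
      qed
      have "(\<integral>\<^sup>+\<omega>. ennreal ((cmod (F \<omega>))\<^sup>2) \<partial>circ)
          \<le> (\<integral>\<^sup>+\<omega>. ennreal (l\<^sup>2) + ennreal (l\<^sup>2 / l powr p) * ennreal (cmod (F \<omega>) powr p) \<partial>circ)"
      proof (rule nn_integral_mono)
        fix \<omega>
        show "ennreal ((cmod (F \<omega>))\<^sup>2)
            \<le> ennreal (l\<^sup>2) + ennreal (l\<^sup>2 / l powr p) * ennreal (cmod (F \<omega>) powr p)"
          using ennreal_leI[OF pw[of "F \<omega>"]]
          by (simp add: ennreal_mult[symmetric] del: times_divide_eq_left times_divide_eq_right)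
      qed
      also have "\<dots> = (\<integral>\<^sup>+\<omega>. ennreal (l\<^sup>2) \<partial>circ)
          + (\<integral>\<^sup>+\<omega>. ennreal (l\<^sup>2 / l powr p) * ennreal (cmod (F \<omega>) powr p) \<partial>circ)"
        using F by (intro nn_integral_add; measurable)
      also have "(\<integral>\<^sup>+\<omega>. ennreal (l\<^sup>2) \<partial>circ) = ennreal (l\<^sup>2 * (2 * pi))"
        by (simp add: emeasure_circ ennreal_mult)
      also have "(\<integral>\<^sup>+\<omega>. ennreal (l\<^sup>2 / l powr p) * ennreal (cmod (F \<omega>) powr p) \<partial>circ)
          = ennreal (l\<^sup>2 / l powr p) * I"
        unfolding I_def using F by (intro nn_integral_cmult) measurable
      also have "\<dots> = ennreal (l\<^sup>2 / l powr p * n powr p)"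
        unfolding i(1) in' by (rule ennreal_mult[symmetric]) simp_all
      also have "\<dots> \<le> ennreal (l\<^sup>2)"
      proof (rule ennreal_leI)
        have "n powr p \<le> l powr p" using l real(1) p2 by (intro powr_mono2) auto
        then show "l\<^sup>2 / l powr p * n powr p \<le> l\<^sup>2"
          using l by (simp add: field_simps mult_left_mono)
      qed
      finally show ?thesis
        by (simp add: ennreal_plus[symmetric] algebra_simps del: ennreal_plus)
    qed
    also have "l\<^sup>2 * (2 * pi + 1) \<le> (3 * l)\<^sup>2"
      using pi_less_4 mult_left_mono[of "2 * pi + 1" 9 "l\<^sup>2"] by (simp add: power_mult_distrib mult.commute)
    finally have "(L_norm 2 F)\<^sup>2 \<le> (ennreal (3 * l))\<^sup>2"
      using l by (simp add: L_norm_2_power2 ennreal_power ennreal_leI)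
    then show ?thesis by (rule ennreal_power2_le_imp_le)
  qed
  have "L_norm 2 F \<le> ennreal (3 * n)"
  proof (rule ennreal_le_epsilon)
    fix e :: real assume "0 < e"
    then have "L_norm 2 F \<le> ennreal (3 * (n + e / 3))" using bound[of "n + e / 3"] real(1) by simp
    then show "L_norm 2 F \<le> ennreal (3 * n) + ennreal e"
      using \<open>0 < e\<close> real(1) by (simp add: ennreal_plus[symmetric] algebra_simps del: ennreal_plus)
  qed
  then show ?thesis using real by (simp add: ennreal_mult)
qed

section \<open>Fourier coefficients and traces\<close>

lemma integrable_circ_continuous:
  fixes f :: "real \<Rightarrow> complex"
  assumes "continuous_on UNIV f"
  shows "integrable circ f"
  using assms continuous_on_subset by (intro continuous_imp_integrable_real) blast

lemma continuous_measurable_circ: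
  fixes f :: "real \<Rightarrow> complex"
  assumes "continuous_on UNIV f"
  shows "f \<in> borel_measurable circ"
  using integrable_circ_continuous[OF assms] by (rule borel_measurable_integrable)

lemma integral_cis:
  "(LINT \<omega>|circ. cis (of_int n * \<omega>)) = (if n = 0 then of_real (2 * pi) else 0)"
proof -
  have cont: "continuous_on UNIV (\<lambda>\<omega>. cis (of_int n * \<omega>))" by (intro continuous_intros)
  have eq: "(LINT \<omega>|circ. cis (of_int n * \<omega>)) = integral {-pi..pi} (\<lambda>\<omega>. cis (of_int n * \<omega>))"
    by (intro lebesgue_integral_eq_integral integrable_circ_continuous cont) simp
  show ?thesis
  proof (cases "n = 0")
    case True
    then show ?thesis using eq by (simp add: scaleR_conv_of_real)
  next
    case False
    let ?E = "\<lambda>z::complex. exp (\<i> * of_int n * z) / (\<i> * of_int n)"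
    have "((\<lambda>\<omega>. cis (of_int n * \<omega>)) has_integral (?E (of_real pi) - ?E (of_real (- pi)))) {-pi..pi}"
    proof (rule fundamental_theorem_of_calculus)
      fix \<omega> :: real
      have "(?E has_field_derivative cis (of_int n * \<omega>)) (at (of_real \<omega>))"
        using False by (auto intro!: derivative_eq_intros simp: cis_conv_exp mult_ac)
      then show "((\<lambda>\<omega>. ?E (of_real \<omega>)) has_vector_derivative cis (of_int n * \<omega>))
          (at \<omega> within {-pi..pi})"
        by (rule has_vector_derivative_real_field)
    qed simp
    moreover have "exp (\<i> * of_int n * of_real pi) = exp (\<i> * of_int n * of_real (- pi))"
      by (rule exp_eq[THEN iffD2]) (auto intro!: exI[of _ n] simp: algebra_simps)
    ultimately have "((\<lambda>\<omega>. cis (of_int n * \<omega>)) has_integral 0) {-pi..pi}" by simp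
    then show ?thesis using eq False by (simp add: integral_unique)
  qed
qed

text \<open>The sign of the exponent is that of the inverse Z-transform: the sequence \<open>x\<close> is recovered from
  its trace \<open>F\<close> as \<open>fourier_coeff F\<close>, and the term of index \<open>t\<close> of a trigonometric sum has frequency
  \<open>- t\<close>.\<close>

definition fourier_coeff :: "(real \<Rightarrow> complex) \<Rightarrow> int \<Rightarrow> complex" where
  "fourier_coeff F t = (LINT \<omega>|circ. F \<omega> * cis (of_int t * \<omega>)) / of_real (2 * pi)"

lemma integrable_mult_bounded_continuous:
  fixes F g :: "real \<Rightarrow> complex"
  assumes "integrable circ F" "continuous_on UNIV g" "\<And>\<omega>. cmod (g \<omega>) \<le> B"
  shows "integrable circ (\<lambda>\<omega>. F \<omega> * g \<omega>)"
proof (rule Bochner_Integration.integrable_bound)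
  show "integrable circ (\<lambda>\<omega>. B *\<^sub>R F \<omega>)" using assms(1) by simp
  show "(\<lambda>\<omega>. F \<omega> * g \<omega>) \<in> borel_measurable circ"
    using assms(1) continuous_measurable_circ[OF assms(2)] by measurable
  have "B \<ge> 0" using assms(3) norm_ge_zero order_trans by blast
  then have "cmod (F \<omega> * g \<omega>) \<le> cmod (B *\<^sub>R F \<omega>)" for \<omega>
    using mult_left_mono[OF assms(3), of "cmod (F \<omega>)" \<omega>] by (simp add: norm_mult mult.commute)
  then show "AE \<omega> in circ. cmod (F \<omega> * g \<omega>) \<le> cmod (B *\<^sub>R F \<omega>)" by simp
qed

lemma integrable_mult_cis:
  assumes "integrable circ F"
  shows "integrable circ (\<lambda>\<omega>. F \<omega> * cis (a * \<omega>))"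
proof (rule integrable_mult_bounded_continuous[OF assms])
  show "continuous_on UNIV (\<lambda>\<omega>. cis (a * \<omega>))" by (intro continuous_intros)
  show "cmod (cis (a * \<omega>)) \<le> 1" for \<omega> by simp
qed

lemma fourier_coeff_diff:
  assumes "integrable circ F" "integrable circ G"
  shows "fourier_coeff (\<lambda>\<omega>. F \<omega> - G \<omega>) t = fourier_coeff F t - fourier_coeff G t"
proof -
  have "(LINT \<omega>|circ. (F \<omega> - G \<omega>) * cis (of_int t * \<omega>))
      = (LINT \<omega>|circ. F \<omega> * cis (of_int t * \<omega>) - G \<omega> * cis (of_int t * \<omega>))"
    by (simp add: left_diff_distrib)
  also have "\<dots> = (LINT \<omega>|circ. F \<omega> * cis (of_int t * \<omega>)) - (LINT \<omega>|circ. G \<omega> * cis (of_int t * \<omega>))"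
    by (intro Bochner_Integration.integral_diff integrable_mult_cis assms)
  finally show ?thesis by (simp add: fourier_coeff_def diff_divide_distrib)
qed

definition trig_sum :: "int set \<Rightarrow> (int \<Rightarrow> complex) \<Rightarrow> real \<Rightarrow> complex" where
  "trig_sum T c \<omega> = (\<Sum>t\<in>T. c t * cis \<omega> powi (- t))"

lemma trig_sum_cis: "trig_sum T c \<omega> = (\<Sum>t\<in>T. c t * cis (of_int (- t) * \<omega>))"
  unfolding trig_sum_def by (simp add: cis_power_int)

lemma continuous_trig_sum: "continuous_on UNIV (trig_sum T c)"
  unfolding trig_sum_cis[abs_def] by (intro continuous_intros)

lemma integrable_trig_sum: "integrable circ (trig_sum T c)"
  by (intro integrable_circ_continuous continuous_trig_sum)

lemma fourier_coeff_trig_sum: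
  assumes "finite T"
  shows "fourier_coeff (trig_sum T c) s = (if s \<in> T then c s else 0)"
proof -
  have "(LINT \<omega>|circ. trig_sum T c \<omega> * cis (of_int s * \<omega>))
      = (LINT \<omega>|circ. (\<Sum>t\<in>T. c t * cis (of_int (s - t) * \<omega>)))"
    by (intro Bochner_Integration.integral_cong refl)
       (simp add: trig_sum_cis sum_distrib_right mult.assoc cis_mult left_diff_distrib)
  also have "\<dots> = (\<Sum>t\<in>T. (LINT \<omega>|circ. c t * cis (of_int (s - t) * \<omega>)))"
    by (intro Bochner_Integration.integral_sum integrable_circ_continuous continuous_intros)
  also have "\<dots> = (\<Sum>t\<in>T. c t * (if s = t then of_real (2 * pi) else 0))"
    by (intro sum.cong refl, subst integral_mult_right_zero, subst integral_cis) auto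
  also have "\<dots> = (if s \<in> T then c s * of_real (2 * pi) else 0)"
    using assms by (simp add: if_distrib cong: if_cong)
  finally show ?thesis by (simp add: fourier_coeff_def)
qed

lemma integral_mult_cnj_trig_sum:
  assumes "finite T" and F: "integrable circ F"
  shows "(LINT \<omega>|circ. F \<omega> * cnj (trig_sum T c \<omega>))
      = of_real (2 * pi) * (\<Sum>t\<in>T. cnj (c t) * fourier_coeff F t)"
proof -
  have "(LINT \<omega>|circ. F \<omega> * cnj (trig_sum T c \<omega>))
      = (LINT \<omega>|circ. (\<Sum>t\<in>T. cnj (c t) * (F \<omega> * cis (of_int t * \<omega>))))"
    by (intro Bochner_Integration.integral_cong refl)
       (simp add: trig_sum_cis sum_distrib_left cis_cnj mult_ac)
  also have "\<dots> = (\<Sum>t\<in>T. (LINT \<omega>|circ. cnj (c t) * (F \<omega> * cis (of_int t * \<omega>))))"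
    by (intro Bochner_Integration.integral_sum integrable_mult_right integrable_mult_cis F)
  also have "\<dots> = (\<Sum>t\<in>T. cnj (c t) * (of_real (2 * pi) * fourier_coeff F t))"
    by (simp add: fourier_coeff_def)
  finally show ?thesis by (simp add: sum_distrib_left mult_ac)
qed

lemma square_integrable_circ:
  assumes F: "F \<in> borel_measurable circ" and fin: "L_norm 2 F < \<infinity>"
  shows "integrable circ (\<lambda>\<omega>. (cmod (F \<omega>))\<^sup>2)" and "integrable circ F"
proof -
  have "(L_norm 2 F)\<^sup>2 < \<infinity>"
    using fin by (simp add: power2_eq_square ennreal_mult_less_top)
  then show sq: "integrable circ (\<lambda>\<omega>. (cmod (F \<omega>))\<^sup>2)"
    using F by (intro integrableI_bounded) (simp_all add: L_norm_2_power2)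
  show "integrable circ F"
  proof (rule Bochner_Integration.integrable_bound)
    show "integrable circ (\<lambda>\<omega>. 1 + (cmod (F \<omega>))\<^sup>2)"
      using sq finite_measure.integrable_const[OF finite_measure_circ]
      by (intro Bochner_Integration.integrable_add)
    have "x \<le> 1 + x\<^sup>2" for x :: real
      using sum_squares_bound[of x 1] by (cases "0 \<le> x") (simp_all add: add_increasing2)
    then show "AE \<omega> in circ. cmod (F \<omega>) \<le> norm (1 + (cmod (F \<omega>))\<^sup>2)" by simp
  qed (rule F)
qed

text \<open>Let \<open>S\<close> be the partial Fourier sum of \<open>F\<close> over \<open>T\<close>, and \<open>N\<close> the sum of the squared coefficients. Then
  \<open>\<langle>F, S\<rangle>\<close> and \<open>\<langle>S, S\<rangle>\<close> both equal \<open>2 * pi * N\<close>, so integrating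
  \<open>2 Re (F \<cdot> cnj S) \<le> \<bar>F\<bar>\<^sup>2 + \<bar>S\<bar>\<^sup>2\<close> gives \<open>2 * pi * N \<le> \<integral>\<bar>F\<bar>\<^sup>2\<close>. The factor \<open>2 * pi \<ge> 1\<close>
  is dropped.\<close>

lemma bessel_inequality:
  assumes F: "F \<in> borel_measurable circ" and T: "finite T"
  shows "ennreal (\<Sum>t\<in>T. (cmod (fourier_coeff F t))\<^sup>2) \<le> (L_norm 2 F)\<^sup>2"
proof (cases "L_norm 2 F < \<infinity>")
  case False
  then show ?thesis by (simp add: less_top[symmetric] power2_eq_square)
next
  case True
  note int = square_integrable_circ[OF F True]
  define S where "S = trig_sum T (fourier_coeff F)"
  define N where "N = (\<Sum>t\<in>T. (cmod (fourier_coeff F t))\<^sup>2)"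
  have N: "of_real N = (\<Sum>t\<in>T. cnj (fourier_coeff F t) * fourier_coeff F t)"
    by (simp add: N_def complex_norm_square mult.commute del: of_real_power)
  have FS: "(LINT \<omega>|circ. F \<omega> * cnj (S \<omega>)) = of_real (2 * pi * N)"
    unfolding S_def integral_mult_cnj_trig_sum[OF T int(2)] by (simp add: N)
  have SS: "(LINT \<omega>|circ. S \<omega> * cnj (S \<omega>)) = of_real (2 * pi * N)"
    unfolding S_def integral_mult_cnj_trig_sum[OF T integrable_trig_sum]
    by (simp add: N fourier_coeff_trig_sum[OF T])
  have contS: "continuous_on UNIV S" unfolding S_def by (rule continuous_trig_sum)
  have bS: "cmod (S \<omega>) \<le> (\<Sum>t\<in>T. cmod (fourier_coeff F t))" for \<omega>
    unfolding S_def trig_sum_cis by (intro order_trans[OF norm_sum] sum_mono) (simp add: norm_mult)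
  have iFS: "integrable circ (\<lambda>\<omega>. F \<omega> * cnj (S \<omega>))"
  proof (rule integrable_mult_bounded_continuous[OF int(2)])
    show "continuous_on UNIV (\<lambda>\<omega>. cnj (S \<omega>))" by (intro continuous_intros contS)
    show "cmod (cnj (S \<omega>)) \<le> (\<Sum>t\<in>T. cmod (fourier_coeff F t))" for \<omega> by (simp add: bS)
  qed
  have iSS: "integrable circ (\<lambda>\<omega>. S \<omega> * cnj (S \<omega>))"
    by (intro integrable_circ_continuous continuous_intros contS)
  have Re_le: "2 * Re (F \<omega> * cnj (S \<omega>)) \<le> (cmod (F \<omega>))\<^sup>2 + Re (S \<omega> * cnj (S \<omega>))" for \<omega>
  proof -
    have "Re (F \<omega> * cnj (S \<omega>)) \<le> cmod (F \<omega>) * cmod (S \<omega>)"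
      by (metis complex_Re_le_cmod complex_mod_cnj norm_mult)
    moreover have "Re (S \<omega> * cnj (S \<omega>)) = (cmod (S \<omega>))\<^sup>2"
      by (metis Re_complex_of_real complex_norm_square)
    ultimately show ?thesis using sum_squares_bound[of "cmod (F \<omega>)" "cmod (S \<omega>)"] by linarith
  qed
  have ReFS: "(LINT \<omega>|circ. Re (F \<omega> * cnj (S \<omega>))) = 2 * pi * N"
    using integral_Re[OF iFS] unfolding FS Re_complex_of_real .
  have ReSS: "(LINT \<omega>|circ. Re (S \<omega> * cnj (S \<omega>))) = 2 * pi * N"
    using integral_Re[OF iSS] unfolding SS Re_complex_of_real .
  have "2 * (2 * pi * N) = (LINT \<omega>|circ. 2 * Re (F \<omega> * cnj (S \<omega>)))"
    unfolding ReFS[symmetric] by (rule integral_mult_right_zero[symmetric])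
  also have "\<dots> \<le> (LINT \<omega>|circ. (cmod (F \<omega>))\<^sup>2 + Re (S \<omega> * cnj (S \<omega>)))"
    by (intro integral_mono Bochner_Integration.integrable_add integrable_mult_right integrable_Re iFS iSS int(1) Re_le)
  also have "\<dots> = (LINT \<omega>|circ. (cmod (F \<omega>))\<^sup>2) + 2 * pi * N"
    unfolding ReSS[symmetric] by (intro Bochner_Integration.integral_add integrable_Re iSS int(1))
  finally have "2 * pi * N \<le> (LINT \<omega>|circ. (cmod (F \<omega>))\<^sup>2)" by linarith
  moreover have "N \<le> 2 * pi * N"
    using pi_gt3 mult_right_mono[of 1 "2 * pi" N] by (simp add: N_def sum_nonneg)
  ultimately have "ennreal N \<le> ennreal (LINT \<omega>|circ. (cmod (F \<omega>))\<^sup>2)" by (intro ennreal_leI) simp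
  also have "\<dots> = (L_norm 2 F)\<^sup>2"
    unfolding L_norm_2_power2 using int(1) by (subst nn_integral_eq_integral) auto
  finally show ?thesis by (simp add: N_def)
qed

corollary ell_norm_fourier_coeff_le:
  assumes F: "F \<in> borel_measurable circ"
  shows "ell_norm 2 (fourier_coeff F) \<le> L_norm 2 F"
proof (rule ennreal_power2_le_imp_le)
  show "(ell_norm 2 (fourier_coeff F))\<^sup>2 \<le> (L_norm 2 F)\<^sup>2"
    unfolding ell_norm_2_power2
  proof (subst nonneg_infsum_complete)
    show "(SUP T\<in>{T. finite T \<and> T \<subseteq> UNIV}. \<Sum>t\<in>T. ennreal ((cmod (fourier_coeff F t))\<^sup>2)) \<le> (L_norm 2 F)\<^sup>2"
      by (rule SUP_least) (simp add: sum_ennreal bessel_inequality[OF F])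
  qed simp
qed

corollary cmod_fourier_coeff_le:
  assumes F: "F \<in> borel_measurable circ"
  shows "ennreal (cmod (fourier_coeff F t)) \<le> L_norm 2 F"
proof -
  have "ennreal (cmod (fourier_coeff F t)) \<le> ell_norm \<infinity> (fourier_coeff F)"
    unfolding ell_norm_def by (simp, rule SUP_upper, simp)
  also note ell_norm_infinity_le_ell_norm_2
  also note ell_norm_fourier_coeff_le[OF F]
  finally show ?thesis .
qed

lemma is_trace_alt:
  "is_trace x F \<longleftrightarrow> F \<in> borel_measurable circ \<and> L_norm 2 F < \<infinity> \<and>
     (\<lambda>n. L_norm 2 (\<lambda>\<omega>. F \<omega> - trig_sum {- int n..int n} x \<omega>)) \<longlonglongrightarrow> 0"
  by (simp add: is_trace_def trig_sum_def)

text \<open>The \<open>t\<close>-th coefficient of the partial sum of order \<open>n \<ge> \<bar>t\<bar>\<close> is \<open>x t\<close>, and coefficients depend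
  continuously on the function in the \<open>L\<^sub>2\<close> norm.\<close>

lemma fourier_coeff_trace:
  assumes "is_trace x F"
  shows "fourier_coeff F t = x t"
proof -
  have F: "F \<in> borel_measurable circ" "L_norm 2 F < \<infinity>"
    and lim: "(\<lambda>n. L_norm 2 (\<lambda>\<omega>. F \<omega> - trig_sum {- int n..int n} x \<omega>)) \<longlonglongrightarrow> 0"
    using assms by (auto simp: is_trace_alt)
  have "ennreal (cmod (fourier_coeff F t - x t)) \<le> L_norm 2 (\<lambda>\<omega>. F \<omega> - trig_sum {- int n..int n} x \<omega>)"
    if n: "n \<ge> nat \<bar>t\<bar>" for n
  proof -
    let ?S = "trig_sum {- int n..int n} x"
    have "fourier_coeff F t - x t = fourier_coeff (\<lambda>\<omega>. F \<omega> - ?S \<omega>) t"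
      using n by (subst fourier_coeff_diff)
        (auto simp: square_integrable_circ[OF F] integrable_trig_sum fourier_coeff_trig_sum)
    moreover have "(\<lambda>\<omega>. F \<omega> - ?S \<omega>) \<in> borel_measurable circ"
      using F(1) continuous_measurable_circ[OF continuous_trig_sum] by measurable
    ultimately show ?thesis using cmod_fourier_coeff_le by metis
  qed
  then have "ennreal (cmod (fourier_coeff F t - x t)) \<le> 0"
    by (intro LIMSEQ_le_const[OF lim]) blast
  then show ?thesis by (simp add: ennreal_eq_0_iff)
qed

text \<open>A substitute for the triangle inequality; the constant 2 costs nothing where both terms on the
  right tend to 0.\<close>

lemma L_norm_2_diff_le:
  assumes F: "F \<in> borel_measurable circ" and G: "G \<in> borel_measurable circ"
  shows "L_norm 2 (\<lambda>\<omega>. F \<omega> - G \<omega>) \<le> 2 * (L_norm 2 F + L_norm 2 G)"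
proof (rule ennreal_power2_le_imp_le)
  have mF: "(\<lambda>\<omega>. ennreal ((cmod (F \<omega>))\<^sup>2)) \<in> borel_measurable circ" using F by measurable
  have mG: "(\<lambda>\<omega>. ennreal ((cmod (G \<omega>))\<^sup>2)) \<in> borel_measurable circ" using G by measurable
  have m2F: "(\<lambda>\<omega>. ennreal 2 * ennreal ((cmod (F \<omega>))\<^sup>2)) \<in> borel_measurable circ" using F by measurable
  have m2G: "(\<lambda>\<omega>. ennreal 2 * ennreal ((cmod (G \<omega>))\<^sup>2)) \<in> borel_measurable circ" using G by measurable
  have *: "(cmod (a - b))\<^sup>2 \<le> 2 * (cmod a)\<^sup>2 + 2 * (cmod b)\<^sup>2" for a b
  proof -
    have "(cmod (a - b))\<^sup>2 \<le> (cmod a + cmod b)\<^sup>2"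
      by (rule power_mono[OF norm_triangle_ineq4 norm_ge_zero])
    also have "\<dots> \<le> 2 * (cmod a)\<^sup>2 + 2 * (cmod b)\<^sup>2"
      using sum_squares_bound[of "cmod a" "cmod b"] by (simp add: power2_sum)
    finally show ?thesis .
  qed
  have "(L_norm 2 (\<lambda>\<omega>. F \<omega> - G \<omega>))\<^sup>2
      \<le> (\<integral>\<^sup>+\<omega>. ennreal 2 * ennreal ((cmod (F \<omega>))\<^sup>2) + ennreal 2 * ennreal ((cmod (G \<omega>))\<^sup>2) \<partial>circ)"
    unfolding L_norm_2_power2
  proof (rule nn_integral_mono)
    fix \<omega>
    have "ennreal 2 * ennreal ((cmod (F \<omega>))\<^sup>2) + ennreal 2 * ennreal ((cmod (G \<omega>))\<^sup>2)
        = ennreal (2 * (cmod (F \<omega>))\<^sup>2 + 2 * (cmod (G \<omega>))\<^sup>2)"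
      by (subst ennreal_plus) (auto simp only: ennreal_mult zero_le_power2 zero_le_numeral mult_nonneg_nonneg)
    then show "ennreal ((cmod (F \<omega> - G \<omega>))\<^sup>2)
        \<le> ennreal 2 * ennreal ((cmod (F \<omega>))\<^sup>2) + ennreal 2 * ennreal ((cmod (G \<omega>))\<^sup>2)"
      using ennreal_leI[OF *[of "F \<omega>" "G \<omega>"]] by (simp only:)
  qed
  also have "\<dots> = ennreal 2 * (L_norm 2 F)\<^sup>2 + ennreal 2 * (L_norm 2 G)\<^sup>2"
    unfolding L_norm_2_power2 nn_integral_add[OF m2F m2G] nn_integral_cmult[OF mF] nn_integral_cmult[OF mG] ..
  also have "\<dots> \<le> ennreal 2 * (L_norm 2 F + L_norm 2 G)\<^sup>2 + ennreal 2 * (L_norm 2 F + L_norm 2 G)\<^sup>2"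
    unfolding power2_eq_square
    by (intro add_mono mult_mono order_refl zero_le add_increasing add_increasing2)
  also have "\<dots> = (2 * (L_norm 2 F + L_norm 2 G))\<^sup>2"
  proof -
    have "ennreal 2 * c + ennreal 2 * c = 2\<^sup>2 * c" for c
      unfolding distrib_right[symmetric] by simp
    then show ?thesis unfolding power_mult_distrib .
  qed
  finally show "(L_norm 2 (\<lambda>\<omega>. F \<omega> - G \<omega>))\<^sup>2 \<le> (2 * (L_norm 2 F + L_norm 2 G))\<^sup>2" .
qed

text \<open>A sequence belongs to its class because of one representative of its trace, whereas the uniform
  estimates speak of all of them. Uniqueness lets the spectral gap be used for every representative.\<close>

lemma trace_unique:
  assumes "is_trace x F" "is_trace x G"
  shows "AE \<omega> in circ. F \<omega> = G \<omega>"
proof -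
  let ?S = "\<lambda>n. trig_sum {- int n..int n} x"
  have F: "F \<in> borel_measurable circ" "(\<lambda>n. L_norm 2 (\<lambda>\<omega>. F \<omega> - ?S n \<omega>)) \<longlonglongrightarrow> 0"
    and G: "G \<in> borel_measurable circ" "(\<lambda>n. L_norm 2 (\<lambda>\<omega>. G \<omega> - ?S n \<omega>)) \<longlonglongrightarrow> 0"
    using assms unfolding is_trace_alt by blast+
  have S: "?S n \<in> borel_measurable circ" for n
    by (intro continuous_measurable_circ continuous_trig_sum)
  have "L_norm 2 (\<lambda>\<omega>. F \<omega> - G \<omega>)
      \<le> 2 * (L_norm 2 (\<lambda>\<omega>. F \<omega> - ?S n \<omega>) + L_norm 2 (\<lambda>\<omega>. G \<omega> - ?S n \<omega>))" for n
    using L_norm_2_diff_le[OF borel_measurable_diff[OF F(1) S[of n]] borel_measurable_diff[OF G(1) S[of n]]]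
    by simp
  moreover have "(\<lambda>n. 2 * (L_norm 2 (\<lambda>\<omega>. F \<omega> - ?S n \<omega>) + L_norm 2 (\<lambda>\<omega>. G \<omega> - ?S n \<omega>))) \<longlonglongrightarrow> 2 * (0 + 0)"
    by (rule tendsto_mult_ennreal[OF tendsto_const tendsto_add[OF F(2) G(2)]]) simp
  ultimately have "L_norm 2 (\<lambda>\<omega>. F \<omega> - G \<omega>) \<le> 2 * (0 + 0)"
    by (intro LIMSEQ_le_const) auto
  then have "(\<integral>\<^sup>+\<omega>. ennreal ((cmod (F \<omega> - G \<omega>))\<^sup>2) \<partial>circ) = 0"
    unfolding L_norm_2_power2[symmetric] by simp
  moreover have "(\<lambda>\<omega>. ennreal ((cmod (F \<omega> - G \<omega>))\<^sup>2)) \<in> borel_measurable circ"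
    using F(1) G(1) by measurable
  ultimately have "AE \<omega> in circ. ennreal ((cmod (F \<omega> - G \<omega>))\<^sup>2) = 0"
    by (rule nn_integral_0_iff_AE[THEN iffD1, rotated])
  then show ?thesis by eventually_elim simp
qed

section \<open>Polynomial predicting kernels\<close>

text \<open>The finitely supported causal kernel whose Z-transform is the polynomial \<open>P\<close> in \<open>1 / z\<close>.\<close>

definition poly_kernel :: "complex poly \<Rightarrow> int \<Rightarrow> complex" where
  "poly_kernel P t = (if t < 0 then 0 else coeff P (nat t))"

lemma poly_kernel_int [simp]: "poly_kernel P (int j) = coeff P j"
  by (simp add: poly_kernel_def)

lemma poly_kernel_eq_0: "t \<notin> int ` {..degree P} \<Longrightarrow> poly_kernel P t = 0"
proof (rule ccontr)
  assume t: "t \<notin> int ` {..degree P}" and "poly_kernel P t \<noteq> 0"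
  then have "t \<ge> 0" "coeff P (nat t) \<noteq> 0" by (auto simp: poly_kernel_def split: if_splits)
  then have "nat t \<le> degree P" "int (nat t) = t" by (auto intro: le_degree)
  then show False using t by (metis atMost_iff imageI)
qed

lemma ztransform_poly_kernel:
  assumes "z \<noteq> 0"
  shows "ztransform (poly_kernel P) z = poly P (1 / z)"
proof -
  have "ztransform (poly_kernel P) z = (\<Sum>\<^sub>\<infinity>t\<in>int ` {..degree P}. poly_kernel P t * z powi (- t))"
    unfolding ztransform_def by (intro infsum_cong_neutral) (auto simp: poly_kernel_eq_0)
  also have "\<dots> = (\<Sum>j\<le>degree P. coeff P j * z powi (- int j))"
    by (simp add: sum.reindex)
  also have "\<dots> = poly P (1 / z)"
    by (simp add: poly_altdef power_int_minus power_one_over inverse_eq_divide)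
  finally show ?thesis .
qed

lemma causal_conv_poly_kernel:
  "causal_conv (poly_kernel P) x t = (\<Sum>j\<le>degree P. coeff P j * x (t - int j))"
proof -
  let ?T = "(\<lambda>j. t - int j) ` {..degree P}"
  have "causal_conv (poly_kernel P) x t = (\<Sum>\<^sub>\<infinity>s\<in>?T. poly_kernel P (t - s) * x s)"
    unfolding causal_conv_def
  proof (rule infsum_cong_neutral)
    fix s assume "s \<in> {..t} - ?T"
    then have "t - s \<notin> int ` {..degree P}" by force
    then show "poly_kernel P (t - s) * x s = 0" by (simp add: poly_kernel_eq_0)
  qed auto
  also have "\<dots> = (\<Sum>j\<le>degree P. coeff P j * x (t - int j))"
    by (simp add: sum.reindex inj_on_def)
  finally show ?thesis .
qed

text \<open>The Z-transform is bounded outside the unit disc, and \<open>P\<close> itself is its continuation in the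
  coordinate \<open>1 / z\<close> at infinity.\<close>

lemma poly_kernel_in_Khat: "poly_kernel P \<in> Khat"
proof -
  let ?h = "ztransform (poly_kernel P)"
  obtain M where M: "M > 0" "\<And>w. w \<in> cball 0 1 \<Longrightarrow> cmod (poly P w) \<le> M"
    using poly_bounded_on[of "cball 0 1" P] by auto
  have hol: "?h holomorphic_on {z. 1 < cmod z}"
  proof (rule holomorphic_transform[of "\<lambda>z. poly P (1 / z)"])
    show "(\<lambda>z. poly P (1 / z)) holomorphic_on {z. 1 < cmod z}"
      by (intro holomorphic_intros) auto
    show "\<And>z. z \<in> {z. 1 < cmod z} \<Longrightarrow> poly P (1 / z) = ?h z"
      by (subst ztransform_poly_kernel) auto
  qed
  have at_infinity: "\<exists>g. g holomorphic_on ball 0 1 \<and> (\<forall>z. 0 < cmod z \<and> cmod z < 1 \<longrightarrow> g z = ?h (1 / z))"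
    by (intro exI[of _ "poly P"]) (auto simp: ztransform_poly_kernel intro!: holomorphic_intros)
  have circle: "(\<lambda>\<omega>. ?h (of_real \<rho> * cis \<omega>)) \<in> borel_measurable circ \<and>
      L_norm \<infinity> (\<lambda>\<omega>. ?h (of_real \<rho> * cis \<omega>)) \<le> ennreal M" if \<rho>: "1 < \<rho>" for \<rho>
  proof -
    have eq: "(\<lambda>\<omega>. ?h (of_real \<rho> * cis \<omega>)) = (\<lambda>\<omega>. poly P (1 / (of_real \<rho> * cis \<omega>)))"
      using \<rho> by (intro ext ztransform_poly_kernel) auto
    have meas: "(\<lambda>\<omega>. ?h (of_real \<rho> * cis \<omega>)) \<in> borel_measurable circ"
      unfolding eq using \<rho> by (intro continuous_measurable_circ continuous_intros) auto
    moreover have "cmod (?h (of_real \<rho> * cis \<omega>)) \<le> M" for \<omega>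
      unfolding fun_cong[OF eq] using \<rho> by (intro M(2)) (simp add: norm_divide norm_mult)
    ultimately show ?thesis
      by (auto simp: L_norm_def intro!: esssup_I ennreal_leI)
  qed
  have "?h \<in> hardy \<infinity>"
  proof -
    have "(SUP \<rho>\<in>{1<..}. L_norm \<infinity> (\<lambda>\<omega>. ?h (of_real \<rho> * cis \<omega>))) \<le> ennreal M"
      using circle by (intro SUP_least) auto
    then show ?thesis using hol at_infinity by (auto simp: hardy_def le_less_trans)
  qed
  moreover have "?h \<in> hardy 2"
  proof -
    have "L_norm 2 (\<lambda>\<omega>. ?h (of_real \<rho> * cis \<omega>)) \<le> 3 * ennreal M" if "1 < \<rho>" for \<rho>
      using L_norm_2_le_L_norm[of _ \<infinity>] circle[OF that] mult_left_mono[of _ _ "3::ennreal"]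
      by (metis (no_types, lifting) ennreal_numeral infinity_ennreal_def order_trans ennreal_less_top zero_le)
    then have "(SUP \<rho>\<in>{1<..}. L_norm 2 (\<lambda>\<omega>. ?h (of_real \<rho> * cis \<omega>))) \<le> 3 * ennreal M"
      by (intro SUP_least) auto
    moreover have "3 * ennreal M < \<infinity>" by (simp add: ennreal_mult_less_top)
    ultimately show ?thesis using hol at_infinity by (auto simp: hardy_def le_less_trans)
  qed
  moreover have "poly_kernel P \<in> ell_plus \<infinity>"
  proof -
    have "cmod (poly_kernel P t) \<le> (\<Sum>j\<le>degree P. cmod (coeff P j))" for t
    proof (cases "t \<in> int ` {..degree P}")
      case True
      then show ?thesis by (auto intro!: member_le_sum)
    qed (simp add: poly_kernel_eq_0 sum_nonneg)
    then have "ell_norm \<infinity> (poly_kernel P) \<le> ennreal (\<Sum>j\<le>degree P. cmod (coeff P j))"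
      by (auto simp: ell_norm_def intro!: SUP_least ennreal_leI)
    then show ?thesis by (auto simp: ell_plus_def ell_def poly_kernel_def le_less_trans)
  qed
  ultimately show ?thesis by (simp add: Khat_def)
qed

section \<open>The anti-causal kernels\<close>

lemma power_series_unique:
  fixes c e :: "nat \<Rightarrow> complex"
  assumes c: "\<And>z. cmod z < 1 \<Longrightarrow> (\<lambda>j. c j * z ^ j) sums f z"
    and e: "\<And>z. cmod z < 1 \<Longrightarrow> (\<lambda>j. e j * z ^ j) sums f z"
  shows "c = e"
proof -
  have rad: "fps_conv_radius (Abs_fps d) > 0"
    if "\<And>z. cmod z < 1 \<Longrightarrow> (\<lambda>j. d j * z ^ j) sums f z" for d
  proof -
    have "summable (\<lambda>j. d j * (1 / 2) ^ j)" using that[of "1 / 2"] by (simp add: sums_iff)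
    then have "conv_radius d \<ge> norm (1 / 2 :: complex)" by (rule conv_radius_geI)
    moreover have "0 < ereal (norm (1 / 2 :: complex))" by simp
    ultimately have "0 < conv_radius d" by (rule less_le_trans[rotated])
    then show ?thesis by (simp add: fps_conv_radius_def)
  qed
  have "Abs_fps c = Abs_fps e"
  proof (rule eval_fps_eqD[OF rad[OF c] rad[OF e]])
    have "eventually (\<lambda>z::complex. z \<in> ball 0 1) (nhds 0)" by (rule eventually_nhds_in_open) auto
    then show "eventually (\<lambda>z. eval_fps (Abs_fps c) z = eval_fps (Abs_fps e) z) (nhds 0)"
    proof eventually_elim
      case (elim z)
      then show ?case using c[of z] e[of z] by (simp add: eval_fps_def sums_iff)
    qed
  qed
  then show ?thesis by (simp add: fps_eq_iff fun_eq_iff)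
qed

lemma sums_infsum_nat:
  fixes f :: "nat \<Rightarrow> complex"
  assumes "summable (\<lambda>j. cmod (f j))"
  shows "f sums (\<Sum>\<^sub>\<infinity>j. f j)"
proof -
  have "(f has_sum suminf f) UNIV"
    by (rule norm_summable_imp_has_sum[OF assms summable_sums[OF summable_norm_cancel[OF assms]]])
  then show ?thesis using has_sum_imp_sums[of f] infsumI[of f] by simp
qed

lemma ell_infinity_bounded:
  assumes "x \<in> ell \<infinity>"
  obtains B where "\<And>t. cmod (x t) \<le> B"
proof -
  obtain B where B: "ell_norm \<infinity> x = ennreal B" "B \<ge> 0" 
    using assms by (cases "ell_norm \<infinity> x") (auto simp: ell_def)
  have "ennreal (cmod (x t)) \<le> ennreal B" for t
    using B(1) by (simp add: ell_norm_def) (metis SUP_upper UNIV_I)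
  then show thesis using B(2) by (intro that[of B]) simp
qed

text \<open>The rational function \<open>(z + b) / (z + a) = 1 + (b - a) / (z + a)\<close> has a geometric expansion with
  ratio \<open>- 1 / a\<close>. By uniqueness of power series its coefficients \<open>e\<close> are the values of the kernel,
  which are therefore absolutely summable, so that the expansion persists on the unit circle.\<close>

lemma K0_power_series:
  assumes "k \<in> K0"
  obtains a b :: real where "1 < \<bar>a\<bar>" "summable (\<lambda>j. cmod (k (- int j)))"
    "\<And>z. cmod z \<le> 1 \<Longrightarrow> (\<lambda>j. k (- int j) * z ^ j) sums ((z + of_real b) / (z + of_real a))"
proof -
  obtain a b :: real where ab: "a < -1 \<or> 1 < a"
    and kz: "\<And>z. cmod z < 1 \<Longrightarrow> ztransform k z = (z + of_real b) / (z + of_real a)"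
    and k: "k \<in> ell \<infinity>" "\<And>t. t > 0 \<Longrightarrow> k t = 0"
    using assms by (auto simp: K0_def)
  have a: "1 < \<bar>a\<bar>" using ab by auto
  obtain B where B: "\<And>t. cmod (k t) \<le> B" using ell_infinity_bounded[OF k(1)] by blast
  define e :: "nat \<Rightarrow> complex" where
    "e j = (if j = 0 then 1 else 0) + of_real ((b - a) / a) * of_real (- 1 / a) ^ j" for j
  have e_sums: "(\<lambda>j. e j * z ^ j) sums ((z + of_real b) / (z + of_real a))" if z: "cmod z \<le> 1" for z
  proof -
    have na: "cmod (of_real (- 1 / a) * z) < 1"
      using z a by (simp add: norm_mult norm_divide divide_simps)
    have za: "z + of_real a \<noteq> 0"
    proof
      assume "z + of_real a = 0"
      then have "z = - of_real a" by (simp add: add_eq_0_iff2)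
      then show False using z a by simp
    qed
    have "(\<lambda>j. (if j = 0 then 1 else 0) + of_real ((b - a) / a) * (of_real (- 1 / a) * z) ^ j)
        sums (1 + of_real ((b - a) / a) * (1 / (1 - of_real (- 1 / a) * z)))"
      using sums_single[of 0 "\<lambda>_. 1 :: complex"]
      by (intro sums_add sums_mult geometric_sums na) simp
    moreover have "1 + of_real ((b - a) / a) * (1 / (1 - of_real (- 1 / a) * z)) = (z + of_real b) / (z + of_real a)"
    proof -
      have a0: "of_real a \<noteq> (0::complex)" using a by auto
      have "1 - of_real (- 1 / a) * z = (z + of_real a) / of_real a" using a0 by (simp add: field_simps)
      then have "of_real ((b - a) / a) * (1 / (1 - of_real (- 1 / a) * z))
          = (of_real b - of_real a) / (z + of_real a)"
        using a0 by simp
      moreover have "1 + (of_real b - of_real a) / (z + of_real a) = (z + of_real b) / (z + of_real a)"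
        using za by (simp add: field_simps)
      ultimately show ?thesis by (simp only:)
    qed
    moreover have "(if j = 0 then 1 else 0) + of_real ((b - a) / a) * (of_real (- 1 / a) * z) ^ j = e j * z ^ j" for j
      unfolding e_def distrib_right power_mult_distrib mult.assoc by simp
    ultimately show ?thesis by simp
  qed
  have k_sums: "(\<lambda>j. k (- int j) * z ^ j) sums ((z + of_real b) / (z + of_real a))" if z: "cmod z < 1" for z
  proof -
    have bij: "bij_betw (\<lambda>j. - int j) UNIV {..0}"
      by (rule bij_betw_byWitness[where f' = "\<lambda>t. nat (- t)"]) auto
    have "ztransform k z = (\<Sum>\<^sub>\<infinity>t\<in>{..0}. k t * z powi (- t))"
      unfolding ztransform_def by (intro infsum_cong_neutral) (auto simp: k(2))
    also have "\<dots> = (\<Sum>\<^sub>\<infinity>j. k (- int j) * z ^ j)"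
      by (subst infsum_reindex_bij_betw[OF bij, symmetric]) simp
    finally have "(\<Sum>\<^sub>\<infinity>j. k (- int j) * z ^ j) = (z + of_real b) / (z + of_real a)"
      using kz[OF z] by simp
    moreover have "summable (\<lambda>j. cmod (k (- int j) * z ^ j))"
    proof (rule summable_comparison_test')
      show "summable (\<lambda>j. B * cmod z ^ j)" using z by (intro summable_mult summable_geometric) simp
      show "norm (cmod (k (- int j) * z ^ j)) \<le> B * cmod z ^ j" for j
        using B[of "- int j"] by (simp add: norm_mult norm_power mult_right_mono)
    qed
    ultimately show ?thesis using sums_infsum_nat by metis
  qed
  have ke: "(\<lambda>j. k (- int j)) = e"
    by (rule power_series_unique[OF k_sums e_sums]) auto
  have "summable (\<lambda>j. cmod (e j))"
  proof (rule summable_comparison_test')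
    show "summable (\<lambda>j. (if j = 0 then 1 else 0) + \<bar>(b - a) / a\<bar> * (1 / \<bar>a\<bar>) ^ j)"
      using a sums_single[of 0 "\<lambda>_. 1 :: real"]
      by (intro summable_add summable_mult summable_geometric) (auto simp: sums_iff)
    show "norm (cmod (e j)) \<le> (if j = 0 then 1 else 0) + \<bar>(b - a) / a\<bar> * (1 / \<bar>a\<bar>) ^ j" for j
    proof -
      have "cmod (e j) \<le> cmod (if j = 0 then 1 else 0) + cmod (of_real ((b - a) / a) * of_real (- 1 / a) ^ j)"
        unfolding e_def by (rule norm_triangle_ineq)
      then show ?thesis by (simp add: norm_mult norm_power norm_divide of_real_diff[symmetric] del: of_real_diff split: if_splits)
    qed
  qed
  then show thesis
    using that[OF a, of b] e_sums unfolding ke[symmetric] by (auto simp: fun_cong[OF ke])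
qed

lemma anticausal_conv_sums:
  assumes k: "summable (\<lambda>j. cmod (k (- int j)))" and x: "\<And>t. cmod (x t) \<le> B"
  shows "(\<lambda>j. k (- int j) * x (t + int j)) sums anticausal_conv k x t"
proof -
  have bij: "bij_betw (\<lambda>j. t + int j) UNIV {t..}"
    by (rule bij_betw_byWitness[where f' = "\<lambda>s. nat (s - t)"]) auto
  have "anticausal_conv k x t = (\<Sum>\<^sub>\<infinity>j. k (- int j) * x (t + int j))"
    unfolding anticausal_conv_def by (subst infsum_reindex_bij_betw[OF bij, symmetric]) simp
  moreover have "summable (\<lambda>j. cmod (k (- int j) * x (t + int j)))"
  proof (rule summable_comparison_test')
    show "summable (\<lambda>j. cmod (k (- int j)) * B)" using k by (rule summable_mult2)
    show "norm (cmod (k (- int j) * x (t + int j))) \<le> cmod (k (- int j)) * B" for j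
      using x by (simp add: norm_mult mult_left_mono)
  qed
  ultimately show ?thesis using sums_infsum_nat by metis
qed

text \<open>Multiplying by \<open>cis (j * \<omega>)\<close> shifts the Fourier coefficients by \<open>j\<close>; absolute summability of
  \<open>c\<close> allows the sum and the integral to be interchanged.\<close>

lemma fourier_coeff_mult_power_series:
  assumes F: "integrable circ F" and c: "summable (\<lambda>j. cmod (c j))"
    and K: "\<And>\<omega>. (\<lambda>j. c j * cis \<omega> ^ j) sums K \<omega>"
  shows "(\<lambda>j. c j * fourier_coeff F (t + int j)) sums fourier_coeff (\<lambda>\<omega>. F \<omega> * K \<omega>) t"
proof -
  define f where "f j \<omega> = c j * (F \<omega> * cis (of_int (t + int j) * \<omega>))" for j :: nat and \<omega>
  have norm_f: "cmod (f j \<omega>) = cmod (c j) * cmod (F \<omega>)" for j \<omega>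
    by (simp add: f_def norm_mult)
  have f_alt: "f j \<omega> = F \<omega> * cis (of_int t * \<omega>) * (c j * cis \<omega> ^ j)" for j \<omega>
  proof -
    have "cis (of_int (t + int j) * \<omega>) = cis (of_int t * \<omega>) * cis \<omega> ^ j"
      by (simp add: Complex.DeMoivre cis_mult distrib_right)
    then show ?thesis by (simp add: f_def mult_ac)
  qed
  have int: "integrable circ (f j)" for j
    unfolding f_def by (intro integrable_mult_right integrable_mult_cis F)
  have "AE \<omega> in circ. summable (\<lambda>j. norm (f j \<omega>))"
    using c by (simp add: norm_f summable_mult2)
  moreover have "summable (\<lambda>j. LINT \<omega>|circ. norm (f j \<omega>))"
    using c by (simp add: norm_f summable_mult2)
  ultimately have "(\<lambda>j. integral\<^sup>L circ (f j)) sums (LINT \<omega>|circ. (\<Sum>j. f j \<omega>))"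
    using int by (intro sums_integral)
  moreover have "(\<Sum>j. f j \<omega>) = F \<omega> * K \<omega> * cis (of_int t * \<omega>)" for \<omega>
  proof -
    have "(\<lambda>j. f j \<omega>) sums (F \<omega> * cis (of_int t * \<omega>) * K \<omega>)"
      unfolding f_alt by (intro sums_mult K)
    then show ?thesis by (simp add: sums_iff mult_ac)
  qed
  ultimately have "(\<lambda>j. integral\<^sup>L circ (f j) / of_real (2 * pi)) sums fourier_coeff (\<lambda>\<omega>. F \<omega> * K \<omega>) t"
    unfolding fourier_coeff_def by (simp add: sums_divide)
  moreover have "integral\<^sup>L circ (f j) / of_real (2 * pi) = c j * fourier_coeff F (t + int j)" for j
    by (simp add: fourier_coeff_def f_def[abs_def])
  ultimately show ?thesis by simp
qed

lemma anticausal_conv_trace: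
  assumes "is_trace x F" and c: "summable (\<lambda>j. cmod (k (- int j)))"
    and K: "\<And>\<omega>. (\<lambda>j. k (- int j) * cis \<omega> ^ j) sums K \<omega>"
  shows "anticausal_conv k x t = fourier_coeff (\<lambda>\<omega>. F \<omega> * K \<omega>) t"
proof -
  have F: "F \<in> borel_measurable circ" "L_norm 2 F < \<infinity>" using assms(1) by (auto simp: is_trace_def)
  have xF: "x t = fourier_coeff F t" for t using fourier_coeff_trace[OF assms(1)] by simp
  obtain B where B: "L_norm 2 F = ennreal B" "B \<ge> 0" using F(2) by (cases "L_norm 2 F") auto
  have "cmod (x t) \<le> B" for t
    using cmod_fourier_coeff_le[OF F(1), of t] B by (simp add: xF)
  then have "(\<lambda>j. k (- int j) * x (t + int j)) sums anticausal_conv k x t"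
    by (rule anticausal_conv_sums[OF c])
  moreover have "(\<lambda>j. k (- int j) * x (t + int j)) sums fourier_coeff (\<lambda>\<omega>. F \<omega> * K \<omega>) t"
    unfolding xF by (rule fourier_coeff_mult_power_series[OF square_integrable_circ(2)[OF F] c K])
  ultimately show ?thesis by (rule sums_unique2)
qed

lemma causal_conv_poly_kernel_trace:
  assumes "is_trace x F"
  shows "causal_conv (poly_kernel P) x t = fourier_coeff (\<lambda>\<omega>. F \<omega> * poly P (cis (- \<omega>))) t"
proof -
  have F: "integrable circ F"
    using assms by (intro square_integrable_circ(2)) (simp_all add: is_trace_def)
  have "fourier_coeff (\<lambda>\<omega>. F \<omega> * poly P (cis (- \<omega>))) t
      = (LINT \<omega>|circ. (\<Sum>j\<le>degree P. coeff P j * (F \<omega> * cis (of_int (t - int j) * \<omega>)))) / of_real (2 * pi)"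
    unfolding fourier_coeff_def
  proof (intro arg_cong2[where f = "(/)"] Bochner_Integration.integral_cong refl)
    fix \<omega>
    have "cis (of_int (t - int j) * \<omega>) = cis (- \<omega>) ^ j * cis (of_int t * \<omega>)" for j
      by (simp add: Complex.DeMoivre cis_mult algebra_simps)
    then show "F \<omega> * poly P (cis (- \<omega>)) * cis (of_int t * \<omega>)
        = (\<Sum>j\<le>degree P. coeff P j * (F \<omega> * cis (of_int (t - int j) * \<omega>)))"
      by (simp add: poly_altdef sum_distrib_left sum_distrib_right mult_ac)
  qed
  also have "\<dots> = (\<Sum>j\<le>degree P. coeff P j * fourier_coeff F (t - int j))"
    by (subst Bochner_Integration.integral_sum)
       (auto intro!: integrable_mult_right integrable_mult_cis F simp: fourier_coeff_def sum_divide_distrib)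
  finally show ?thesis by (simp add: causal_conv_poly_kernel fourier_coeff_trace[OF assms])
qed

section \<open>Prediction\<close>

text \<open>The anti-causal convolution multiplies the trace by \<open>K\<close>, the prediction multiplies it by
  \<open>P (cis (- \<omega>))\<close>. The error is the sequence of Fourier coefficients of the difference, to which
  Bessel's inequality applies; only values of \<open>\<omega>\<close> with \<open>F \<omega> \<noteq> 0\<close> contribute.\<close>

lemma prediction_error_le:
  assumes tr: "is_trace x F" and c: "summable (\<lambda>j. cmod (k (- int j)))"
    and K: "\<And>\<omega>. (\<lambda>j. k (- int j) * cis \<omega> ^ j) sums K \<omega>"
    and M: "0 \<le> M" "AE \<omega> in circ. F \<omega> \<noteq> 0 \<longrightarrow> cmod (K \<omega> - poly P (cis (- \<omega>))) \<le> M"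
    and contK: "continuous_on UNIV K"
  shows "ell_norm 2 (\<lambda>t. anticausal_conv k x t - causal_conv (poly_kernel P) x t) \<le> ennreal M * L_norm 2 F"
proof -
  have F: "F \<in> borel_measurable circ" "L_norm 2 F < \<infinity>" using tr by (auto simp: is_trace_def)
  note intF = square_integrable_circ(2)[OF F]
  let ?Q = "\<lambda>\<omega>. poly P (cis (- \<omega>))"
  have contQ: "continuous_on UNIV ?Q" by (intro continuous_intros)
  obtain BQ where BQ: "\<And>w. w \<in> cball 0 1 \<Longrightarrow> cmod (poly P w) \<le> BQ"
    using poly_bounded_on[of "cball 0 1" P] by auto
  have boundK: "cmod (K \<omega>) \<le> (\<Sum>j. cmod (k (- int j)))" for \<omega>
    using summable_norm[of "\<lambda>j. k (- int j) * cis \<omega> ^ j"] c K[of \<omega>]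
    by (simp add: norm_mult norm_power sums_iff)
  have err: "(\<lambda>t. anticausal_conv k x t - causal_conv (poly_kernel P) x t)
      = fourier_coeff (\<lambda>\<omega>. F \<omega> * K \<omega> - F \<omega> * ?Q \<omega>)"
  proof
    fix t
    have "fourier_coeff (\<lambda>\<omega>. F \<omega> * K \<omega> - F \<omega> * ?Q \<omega>) t
        = fourier_coeff (\<lambda>\<omega>. F \<omega> * K \<omega>) t - fourier_coeff (\<lambda>\<omega>. F \<omega> * ?Q \<omega>) t"
      by (intro fourier_coeff_diff integrable_mult_bounded_continuous[OF intF contK boundK]
          integrable_mult_bounded_continuous[OF intF contQ BQ]) simp
    then show "anticausal_conv k x t - causal_conv (poly_kernel P) x t
        = fourier_coeff (\<lambda>\<omega>. F \<omega> * K \<omega> - F \<omega> * ?Q \<omega>) t"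
      by (simp add: anticausal_conv_trace[OF tr c K] causal_conv_poly_kernel_trace[OF tr])
  qed
  have "ell_norm 2 (\<lambda>t. anticausal_conv k x t - causal_conv (poly_kernel P) x t)
      \<le> L_norm 2 (\<lambda>\<omega>. F \<omega> * K \<omega> - F \<omega> * ?Q \<omega>)"
    unfolding err
    by (intro ell_norm_fourier_coeff_le borel_measurable_diff borel_measurable_times F(1)
        continuous_measurable_circ contK contQ)
  also have "\<dots> \<le> ennreal M * L_norm 2 F"
  proof (rule L_norm_2_mono_AE[OF _ M(1) F(1)], use M(2) in eventually_elim)
    fix \<omega> assume *: "F \<omega> \<noteq> 0 \<longrightarrow> cmod (K \<omega> - ?Q \<omega>) \<le> M"
    have "cmod (F \<omega> * K \<omega> - F \<omega> * ?Q \<omega>) = cmod (K \<omega> - ?Q \<omega>) * cmod (F \<omega>)"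
      by (simp add: right_diff_distrib[symmetric] norm_mult mult.commute)
    also have "\<dots> \<le> M * cmod (F \<omega>)" using * by (cases "F \<omega> = 0") (auto intro!: mult_right_mono)
    finally show "cmod (F \<omega> * K \<omega> - F \<omega> * ?Q \<omega>) \<le> M * cmod (F \<omega>)" .
  qed
  finally show ?thesis .
qed

text \<open>With \<open>w = cis (- \<omega>) = 1 / cis \<omega>\<close> the transfer function becomes \<open>(1 + b w) / (1 + a w)\<close>: up to
  a linear factor a simple pole at \<open>- 1 / a\<close>, inside the unit disc.\<close>

lemma transfer_function_approximable:
  fixes a b :: real
  assumes a: "1 < \<bar>a\<bar>" and st: "s < t" "t - s < 2 * pi" and e: "0 < e"
  obtains P where "\<And>\<omega>. cis (- \<omega>) \<in> cis ` {s..t} \<Longrightarrow>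
    cmod ((cis \<omega> + of_real b) / (cis \<omega> + of_real a) - poly P (cis (- \<omega>))) \<le> e"
proof -
  let ?A = "cis ` {s..t}"
  have bA: "bounded ?A" by (rule boundedI[of _ 1]) auto
  have a0: "of_real a \<noteq> (0::complex)" using a by auto
  have "poly_approximable ?A (\<lambda>w. 1 / (w - of_real (- 1 / a)))"
    using a by (intro arc_simple_pole_approximable st) (auto simp: norm_divide)
  then have "poly_approximable ?A (\<lambda>w. poly [:1 / of_real a, of_real b / of_real a:] w * (1 / (w - of_real (- 1 / a))))"
    by (intro poly_approximable_mult[OF bA] poly_approximable_poly)
  then obtain P where P: "\<And>w. w \<in> ?A \<Longrightarrow>
      cmod (poly [:1 / of_real a, of_real b / of_real a:] w * (1 / (w - of_real (- 1 / a))) - poly P w) \<le> e"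
    using e by (rule poly_approximableD) blast
  have "(cis \<omega> + of_real b) / (cis \<omega> + of_real a)
      = poly [:1 / of_real a, of_real b / of_real a:] (cis (- \<omega>)) * (1 / (cis (- \<omega>) - of_real (- 1 / a)))" for \<omega>
  proof -
    let ?w = "cis (- \<omega>)"
    have w: "cis \<omega> = 1 / ?w" "?w \<noteq> 0" by (simp_all add: eq_divide_eq cis_mult)
    have "cmod (of_real a * ?w) > 1" using a by (simp add: norm_mult)
    then have "1 + of_real a * ?w \<noteq> 0"
      by (metis add_eq_0_iff norm_minus_cancel norm_one less_irrefl)
    then show ?thesis unfolding w(1) using w(2) a0 by (simp add: divide_simps) (simp add: algebra_simps)
  qed
  then show thesis using P that by metis
qed

lemma uniform_predictor:
  assumes k: "k \<in> K0" and st: "s < t" "t - s < 2 * pi" and e: "0 < e"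
    and supp: "\<And>x. x \<in> \<X> \<Longrightarrow> \<exists>F. is_trace x F \<and> (AE \<omega> in circ. F \<omega> \<noteq> 0 \<longrightarrow> cis (- \<omega>) \<in> cis ` {s..t})"
  shows "\<exists>\<kappa>\<in>Khat. \<forall>x\<in>\<X>. \<forall>F. is_trace x F \<longrightarrow>
    ell_norm 2 (\<lambda>t. anticausal_conv k x t - causal_conv \<kappa> x t) \<le> ennreal e * L_norm 2 F"
proof -
  obtain a b :: real where a: "1 < \<bar>a\<bar>" and c: "summable (\<lambda>j. cmod (k (- int j)))"
    and K: "\<And>z. cmod z \<le> 1 \<Longrightarrow> (\<lambda>j. k (- int j) * z ^ j) sums ((z + of_real b) / (z + of_real a))"
    using K0_power_series[OF k] by metis
  let ?K = "\<lambda>\<omega>. (cis \<omega> + of_real b) / (cis \<omega> + of_real a)"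
  obtain P where P: "\<And>\<omega>. cis (- \<omega>) \<in> cis ` {s..t} \<Longrightarrow> cmod (?K \<omega> - poly P (cis (- \<omega>))) \<le> e"
    using transfer_function_approximable[OF a st e] by metis
  have "cis \<omega> + of_real a \<noteq> 0" for \<omega>
    using a by (metis add_eq_0_iff norm_cis norm_minus_cancel norm_of_real less_irrefl)
  then have contK: "continuous_on UNIV ?K" by (intro continuous_intros) auto
  show ?thesis
  proof (intro bexI[of _ "poly_kernel P"] ballI allI impI poly_kernel_in_Khat)
    fix x F assume x: "x \<in> \<X>" and tr: "is_trace x F"
    obtain G where G: "is_trace x G" "AE \<omega> in circ. G \<omega> \<noteq> 0 \<longrightarrow> cis (- \<omega>) \<in> cis ` {s..t}"
      using supp[OF x] by blast
    have "AE \<omega> in circ. F \<omega> \<noteq> 0 \<longrightarrow> cmod (?K \<omega> - poly P (cis (- \<omega>))) \<le> e"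
      using trace_unique[OF tr G(1)] G(2) by eventually_elim (auto intro: P)
    then show "ell_norm 2 (\<lambda>t. anticausal_conv k x t - causal_conv (poly_kernel P) x t) \<le> ennreal e * L_norm 2 F"
      using e K by (intro prediction_error_le[OF tr c _ _ _ contK]) auto
  qed
qed

text \<open>For high frequencies the two intervals \<open>[\<Omega>, pi]\<close> and \<open>[- pi, - \<Omega>]\<close> are joined across \<open>pi\<close> to
  the single arc from \<open>\<Omega>\<close> to \<open>2 * pi - \<Omega>\<close>. In either case the spectral gap makes the arc proper.\<close>

lemma spectral_support_in_arc:
  assumes "0 < \<Omega>" "\<Omega> < pi" "\<X> \<in> {band_limited \<Omega>, high_frequency \<Omega>}"
  obtains s t where "s < t" "t - s < 2 * pi"
    "\<And>x. x \<in> \<X> \<Longrightarrow> \<exists>F. is_trace x F \<and> (AE \<omega> in circ. F \<omega> \<noteq> 0 \<longrightarrow> cis (- \<omega>) \<in> cis ` {s..t})"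
proof (cases "\<X> = band_limited \<Omega>")
  case True
  show thesis
  proof (rule that[of "- \<Omega>" \<Omega>])
    fix x assume "x \<in> \<X>"
    then obtain F where F: "is_trace x F" "AE \<omega> in circ. \<bar>\<omega>\<bar> > \<Omega> \<longrightarrow> F \<omega> = 0"
      using True by (auto simp: band_limited_def)
    from F(2) have "AE \<omega> in circ. F \<omega> \<noteq> 0 \<longrightarrow> cis (- \<omega>) \<in> cis ` {- \<Omega>..\<Omega>}"
      by eventually_elim (intro impI imageI, auto)
    with F(1) show "\<exists>F. is_trace x F \<and> (AE \<omega> in circ. F \<omega> \<noteq> 0 \<longrightarrow> cis (- \<omega>) \<in> cis ` {- \<Omega>..\<Omega>})"
      by blast
  qed (use assms in auto)
next
  case False
  show thesis
  proof (rule that[of \<Omega> "2 * pi - \<Omega>"])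
    fix x assume "x \<in> \<X>"
    then obtain F where F: "is_trace x F" "AE \<omega> in circ. \<bar>\<omega>\<bar> < \<Omega> \<longrightarrow> F \<omega> = 0"
      using False assms by (auto simp: high_frequency_def)
    from F(2) AE_space have "AE \<omega> in circ. F \<omega> \<noteq> 0 \<longrightarrow> cis (- \<omega>) \<in> cis ` {\<Omega>..2 * pi - \<Omega>}"
    proof (eventually_elim, intro impI)
      fix \<omega> assume *: "\<bar>\<omega>\<bar> < \<Omega> \<longrightarrow> F \<omega> = 0" "\<omega> \<in> space circ" "F \<omega> \<noteq> 0"
      show "cis (- \<omega>) \<in> cis ` {\<Omega>..2 * pi - \<Omega>}"
      proof (cases "\<omega> \<le> 0")
        case True
        then show ?thesis using * assms by (intro imageI) auto
      next
        case False
        have "cis (- \<omega>) = cis (2 * pi - \<omega>)"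
          by (simp add: complex_eq_iff cos_diff sin_diff)
        moreover have "2 * pi - \<omega> \<in> {\<Omega>..2 * pi - \<Omega>}" using * False assms by auto
        ultimately show ?thesis by blast
      qed
    qed
    with F(1) show "\<exists>F. is_trace x F \<and> (AE \<omega> in circ. F \<omega> \<noteq> 0 \<longrightarrow> cis (- \<omega>) \<in> cis ` {\<Omega>..2 * pi - \<Omega>})"
      by blast
  qed (use assms in auto)
qed

theorem theorem1:
  fixes \<Omega> :: real and \<X> :: "(int \<Rightarrow> complex) set"
  assumes "0 < \<Omega>" and "\<Omega> < pi"
    and "\<X> \<in> {band_limited \<Omega>, high_frequency \<Omega>}"
  shows "weakly_predictable 2 K0 \<X> \<and>
         weakly_predictable_uniformly \<infinity> K0 (L_norm 2) \<X> \<and>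
         (\<forall>q::ennreal. q > 2 \<longrightarrow> weakly_predictable_uniformly 2 K0 (L_norm q) \<X>)"
proof (rule spectral_support_in_arc[OF assms])
  fix s t :: real
  assume st: "s < t" "t - s < 2 * pi"
    and supp: "\<And>x. x \<in> \<X> \<Longrightarrow>
      \<exists>F. is_trace x F \<and> (AE \<omega> in circ. F \<omega> \<noteq> 0 \<longrightarrow> cis (- \<omega>) \<in> cis ` {s..t})"
  define err where "err k \<kappa> x = (\<lambda>t. anticausal_conv k x t - causal_conv \<kappa> x t)" for k \<kappa> x
  have main: "\<exists>\<kappa>\<in>Khat. \<forall>x\<in>\<X>. \<forall>F. is_trace x F \<longrightarrow> ell_norm 2 (err k \<kappa> x) \<le> ennreal e * L_norm 2 F"
    if "k \<in> K0" "0 < e" for k e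
    unfolding err_def by (rule uniform_predictor[OF that(1) st that(2) supp])
  have "weakly_predictable 2 K0 \<X>"
    unfolding weakly_predictable_def err_def[symmetric]
  proof
    fix k assume k: "k \<in> K0"
    have "\<exists>\<kappa>. \<kappa> \<in> Khat \<and> (\<forall>x\<in>\<X>. \<forall>F. is_trace x F \<longrightarrow>
        ell_norm 2 (err k \<kappa> x) \<le> ennreal (inverse (real (Suc m))) * L_norm 2 F)" for m
      using main[OF k, of "inverse (real (Suc m))"] by auto
    then obtain \<kappa> where \<kappa>: "\<And>m. \<kappa> m \<in> Khat"
      "\<And>m x F. x \<in> \<X> \<Longrightarrow> is_trace x F \<Longrightarrow>
        ell_norm 2 (err k (\<kappa> m) x) \<le> ennreal (inverse (real (Suc m))) * L_norm 2 F"
      by metis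
    have "(\<lambda>m. ell_norm 2 (err k (\<kappa> m) x)) \<longlonglongrightarrow> 0" if x: "x \<in> \<X>" for x
    proof -
      obtain F where F: "is_trace x F" using supp[OF x] by blast
      then have fin: "L_norm 2 F < \<infinity>" by (simp add: is_trace_def)
      have inv: "(\<lambda>m. ennreal (inverse (real (Suc m)))) \<longlonglongrightarrow> 0"
        using tendsto_ennrealI[OF LIMSEQ_inverse_real_of_nat] by (simp only: ennreal_0)
      have "(\<lambda>m. ennreal (inverse (real (Suc m))) * L_norm 2 F) \<longlonglongrightarrow> 0 * L_norm 2 F"
        by (rule tendsto_mult_ennreal[OF inv tendsto_const]) (use fin in simp)
      then have "(\<lambda>m. ennreal (inverse (real (Suc m))) * L_norm 2 F) \<longlonglongrightarrow> 0" by (simp only: mult_zero_left)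
      then show ?thesis
        by (rule tendsto_sandwich[OF _ _ tendsto_const, rotated 2])
           (simp_all only: \<kappa>(2)[OF x F] zero_le eventually_True)
    qed
    with \<kappa>(1) show "\<exists>\<kappa>. (\<forall>m. \<kappa> m \<in> Khat) \<and> (\<forall>x\<in>\<X>. (\<lambda>m. ell_norm 2 (err k (\<kappa> m) x)) \<longlonglongrightarrow> 0)"
      by blast
  qed
  moreover have "weakly_predictable_uniformly \<infinity> K0 (L_norm 2) \<X>"
    unfolding weakly_predictable_uniformly_def err_def[symmetric]
  proof (intro ballI allI impI)
    fix k and e :: real assume "k \<in> K0" "e > 0"
    then obtain \<kappa> where \<kappa>: "\<kappa> \<in> Khat" "\<And>x F. x \<in> \<X> \<Longrightarrow> is_trace x F \<Longrightarrow>
        ell_norm 2 (err k \<kappa> x) \<le> ennreal e * L_norm 2 F"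
      using main[of k e] by auto
    have "ell_norm \<infinity> (err k \<kappa> x) \<le> ennreal e * L_norm 2 F" if "x \<in> \<X>" "is_trace x F" for x F
      by (rule order_trans[OF ell_norm_infinity_le_ell_norm_2 \<kappa>(2)[OF that]])
    with \<kappa>(1) show "\<exists>\<kappa>\<in>Khat. \<forall>x\<in>\<X>. \<forall>F. is_trace x F \<longrightarrow> ell_norm \<infinity> (err k \<kappa> x) \<le> ennreal e * L_norm 2 F"
      by blast
  qed
  moreover have "weakly_predictable_uniformly 2 K0 (L_norm q) \<X>" if q: "2 < q" for q
    unfolding weakly_predictable_uniformly_def err_def[symmetric]
  proof (intro ballI allI impI)
    fix k and e :: real assume k: "k \<in> K0" and e: "e > 0"
    then obtain \<kappa> where \<kappa>: "\<kappa> \<in> Khat" "\<And>x F. x \<in> \<X> \<Longrightarrow> is_trace x F \<Longrightarrow>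
        ell_norm 2 (err k \<kappa> x) \<le> ennreal (e / 3) * L_norm 2 F"
      using main[OF k, of "e / 3"] by auto
    have "ell_norm 2 (err k \<kappa> x) \<le> ennreal e * L_norm q F" if "x \<in> \<X>" "is_trace x F" for x F
    proof -
      have "F \<in> borel_measurable circ" using that(2) by (simp add: is_trace_def)
      then have "ennreal (e / 3) * L_norm 2 F \<le> ennreal (e / 3) * (3 * L_norm q F)"
        by (intro mult_left_mono L_norm_2_le_L_norm q) auto
      also have "ennreal (e / 3) * (3 * L_norm q F) = (ennreal (e / 3) * ennreal 3) * L_norm q F"
        by (simp add: mult.assoc)
      also have "ennreal (e / 3) * ennreal 3 = ennreal e"
        using e by (subst ennreal_mult[symmetric]) auto
      finally show ?thesis by (rule order_trans[OF \<kappa>(2)[OF that]])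
    qed
    with \<kappa>(1) show "\<exists>\<kappa>\<in>Khat. \<forall>x\<in>\<X>. \<forall>F. is_trace x F \<longrightarrow> ell_norm 2 (err k \<kappa> x) \<le> ennreal e * L_norm q F"
      by blast
  qed
  ultimately show ?thesis by blast
qed

end
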